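(* In the setting described in the context, suppose $(r,\eta)\in\mathcal K$ and that there exist constants $\hat c_1,\hat c_2>0$ with $\|A_dh\|\ge\hat c_d\|h\|$ for all $h\in\mathbb C^{n_d}$, $d=1,2$. Then every limit point of the sequence $\{X^n\}$ is a stationary point of the saddle point problem $\max_{\Lambda_{1,2},\Lambda_{2,1},\Gamma_1,\Gamma_2}\min_{u_1,u_2,v,z_1,z_2}\mathcal L$, i.e. a point at which the gradient of $\mathcal L$ with respect to all of its variables vanishes.
   Context: Notation: $\|\cdot\|$ is the Euclidean norm on vectors and the induced operator (spectral) norm on linear maps; $\Re$ denotes real part and $\langle a,b\rangle=\sum_j a(j)\overline{b(j)}$. Real-valued functions of complex vectors are differentiated by identifying $\mathbb C^k$ with $\mathbb R^{2k}$; gradients are real gradients written as complex vectors. Metric: fix $\epsilon\in(0,1)$ and put $L:=\frac2\epsilon-1$. For $x\in\mathbb C$, $b\ge0$, let $g_\epsilon(x;b)=\frac{1-\epsilon}{2}(b-\frac1\epsilon|x|^2)$ if $|x|<\epsilon\sqrt b$ and $g_\epsilon(x;b)=\frac12(|x|-\sqrt b)^2$ otherwise; for $z\in\mathbb C^k$, $f\in\mathbb R^k_+$, $\mathcal G_\epsilon(z;f)=\sum_j g_\epsilon(z(j);f(j))$. Domain decomposition: $\Omega=\{0,\dots,n-1\}$ (pixels of an image $u\in\mathbb C^n$) is covered by two index sets $\Omega_1,\Omega_2$ with $\Omega_1\cup\Omega_2=\Omega$, $|\Omega_d|=n_d$, $\Omega_d=\{l^d_0<\dots<l^d_{n_d-1}\}$,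 and nonempty overlap $\Omega_{1,2}=\Omega_1\cap\Omega_2=\{\hat l_0<\dots<\hat l_{\hat n-1}\}$. Restrictions: $R_d:\mathbb C^n\to\mathbb C^{n_d}$, $(R_du)(j)=u(l^d_j)$; $R_{1,2}:\mathbb C^n\to\mathbb C^{\hat n}$, $(R_{1,2}u)(j)=u(\hat l_j)$. Set $\pi_{1,2}:=R_{1,2}R_1^T:\mathbb C^{n_1}\to\mathbb C^{\hat n}$ and $\pi_{2,1}:=R_{1,2}R_2^T:\mathbb C^{n_2}\to\mathbb C^{\hat n}$. Forward operators: a probe $w\in\mathbb C^{\bar m}$ is given, $\mathcal F$ is the normalized (unitary) discrete Fourier transform on $\mathbb C^{\bar m}$, $\circ$ is entrywise product. For $d=1,2$ there are binary matrices $\mathcal S^d_j\in\{0,1\}^{\bar m\times n_d}$, $j=0,\dots,J_d-1$, each row of which contains exactly one entry equal to $1$. Define $A_d:\mathbb C^{n_d}\to\mathbb C^{m_d}$, $m_d=J_d\bar m$, by $A_du_d=\big(\mathcal F(w\circ\mathcal S^d_0u_d);\dots;\mathcal F(w\circ\mathcal S^d_{J_d-1}u_d)\big)$ (stacked). Data $f_d\in\mathbb R_+^{m_d}$, $d=1,2$, are given. Augmented Lagrangian, with parameters $r,\eta>0$, for $u_d\in\mathbb C^{n_d}$, $v,\Lambda_{1,2},\Lambda_{2,1}\in\mathbb C^{\hat n}$, $z_d,\Gamma_d\in\mathbb C^{m_d}$: $$\mathcal L(u_1,u_2,v,z_1,z_2,\Lambda_{1,2},\Lambda_{2,1},\Gamma_1,\Gamma_2)=\sum_{d=1}^2\mathcal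 G_\epsilon(z_d;f_d)+r\sum_{d=1}^2\Big(\Re\langle\Lambda_{d,3-d},\pi_{d,3-d}u_d-v\rangle+\tfrac12\|\pi_{d,3-d}u_d-v\|^2\Big)+\eta\sum_{d=1}^2\Big(\Re\langle\Gamma_d,A_du_d-z_d\rangle+\tfrac12\|A_du_d-z_d\|^2\Big).$$ Algorithm (OD$^2$P): start with $u_d^0=\mathbf 1$ (all ones), any $v^0\in\mathbb C^{\hat n}$, $z_d^0=A_du_d^0$, $\Gamma_d^0=0$, $\Lambda_{1,2}^0=\Lambda_{2,1}^0=0$. For $n\ge0$ and $d=1,2$: (i) $z_d^{n+1}$ is a minimizer of $z\mapsto\mathcal G_\epsilon(z;f_d)+\frac\eta2\|z-(\Gamma_d^n+A_du_d^n)\|^2$, and $v^{n+1}=\frac12\sum_{d=1}^2(\pi_{d,3-d}u_d^n+\Lambda^n_{d,3-d})$; (ii) $\Gamma_d^{n+1}=\Gamma_d^n+A_du_d^n-z_d^{n+1}$; (iii) $u_d^{n+1}$ is a minimizer of $u\mapsto\frac\eta2\|A_du+\Gamma_d^{n+1}-z_d^{n+1}\|^2+\frac r2\|\pi_{d,3-d}u-v^{n+1}+\Lambda^n_{d,3-d}\|^2$; (iv) $\Lambda^{n+1}_{d,3-d}=\Lambda^n_{d,3-d}+\pi_{d,3-d}u_d^{n+1}-v^{n+1}$. Write $X^n=(u_1^n,u_2^n,v^n,z_1^n,z_2^n,\Lambda_{1,2}^n,\Lambda_{2,1}^n,\Gamma_1^n,\Gamma_2^n)$. Parameter set: $\mathcal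 K$ is the set of $(r,\eta)\in\mathbb R_+^2$ such that $\eta\ge1$, $r-\eta\max\{2\|A_1^*A_1\|,2\|A_2^*A_2\|,\|\pi_{1,2}A_1^*\|,\|\pi_{2,1}A_2^*\|\}>0$, and $\frac{\eta-3L}{2}-\frac{L^2}{\eta}-\frac{2(L+\eta)^2}{r^2}\max\{\|\pi_{1,2}A_1^*\|^2,\|\pi_{2,1}A_2^*\|^2\}>0$. *)

theory Defs
  imports Complex_Main "HOL-Library.Function_Algebras"
begin

text \<open>Vectors in C^k are represented as functions nat => complex, only the
entries with index < k being relevant; matrices of size r x c as
nat => nat => complex, only entries (i,k) with i < r, k < c being relevant.\<close>

type_synonym cvec = "nat \<Rightarrow> complex"
type_synonym cmat = "nat \<Rightarrow> nat \<Rightarrow> complex"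

definition mv :: "cmat \<Rightarrow> nat \<Rightarrow> nat \<Rightarrow> cvec \<Rightarrow> cvec" where
  "mv M r c x = (\<lambda>i. if i < r then (\<Sum>k<c. M i k * x k) else 0)"

definition mm :: "cmat \<Rightarrow> cmat \<Rightarrow> nat \<Rightarrow> cmat" where
  "mm M N c = (\<lambda>i k. \<Sum>j<c. M i j * N j k)"

definition tr :: "cmat \<Rightarrow> cmat" where
  "tr M = (\<lambda>i k. M k i)"

definition adj :: "cmat \<Rightarrow> cmat" where
  "adj M = (\<lambda>i k. cnj (M k i))"

definition nsq :: "nat \<Rightarrow> cvec \<Rightarrow> real" where
  "nsq k x = (\<Sum>j<k. (cmod (x j))\<^sup>2)"

definition vnorm :: "nat \<Rightarrow> cvec \<Rightarrow> real" where
  "vnorm k x = sqrt (nsq k x)"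

definition reip :: "nat \<Rightarrow> cvec \<Rightarrow> cvec \<Rightarrow> real" where
  "reip k a b = Re (\<Sum>j<k. a j * cnj (b j))"

definition opnorm :: "cmat \<Rightarrow> nat \<Rightarrow> nat \<Rightarrow> real" where
  "opnorm M r c = Sup {vnorm r (mv M r c x) | x. vnorm c x \<le> 1}"

definition veq :: "nat \<Rightarrow> cvec \<Rightarrow> cvec \<Rightarrow> bool" where
  "veq k x y \<longleftrightarrow> (\<forall>j<k. x j = y j)"

definition g_eps :: "real \<Rightarrow> complex \<Rightarrow> real \<Rightarrow> real" where
  "g_eps eps x b = (if cmod x < eps * sqrt b then (1 - eps) / 2 * (b - (cmod x)\<^sup>2 / eps)
                    else (cmod x - sqrt b)\<^sup>2 / 2)"

definition G_eps :: "real \<Rightarrow> nat \<Rightarrow> cvec \<Rightarrow> (nat \<Rightarrow> real) \<Rightarrow> real" where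
  "G_eps eps k z f = (\<Sum>j<k. g_eps eps (z j) (f j))"

text \<open>Restriction matrix R : C^n -> C^{card Om}, (R u)(j) = u(l_j), where
l_0 < ... < l_{card Om - 1} enumerate Om increasingly.\<close>
definition Rmat :: "nat set \<Rightarrow> cmat" where
  "Rmat Om = (\<lambda>j i. if i = sorted_list_of_set Om ! j then 1 else 0)"

definition pimat :: "nat \<Rightarrow> nat set \<Rightarrow> nat set \<Rightarrow> cmat" where
  "pimat n Om12 Omd = mm (Rmat Om12) (tr (Rmat Omd)) n"

definition Fmat :: "nat \<Rightarrow> cmat" where
  "Fmat mbar = (\<lambda>p l. cis (- 2 * pi * real p * real l / real mbar) / complex_of_real (sqrt (real mbar)))"

text \<open>A_d as an (J mbar) x n_d matrix: block j (rows j*mbar .. j*mbar+mbar-1)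
is F diag(w) S_j.\<close>
definition Amat :: "nat \<Rightarrow> cvec \<Rightarrow> (nat \<Rightarrow> cmat) \<Rightarrow> cmat" where
  "Amat mbar w S = (\<lambda>i k. \<Sum>l<mbar. Fmat mbar (i mod mbar) l * w l * S (i div mbar) l k)"

definition scan_mats :: "nat \<Rightarrow> nat \<Rightarrow> nat \<Rightarrow> (nat \<Rightarrow> cmat) \<Rightarrow> bool" where
  "scan_mats J mbar nd S \<longleftrightarrow>
     (\<forall>j<J. \<forall>i<mbar. \<forall>k<nd. S j i k = 0 \<or> S j i k = 1) \<and>
     (\<forall>j<J. \<forall>i<mbar. \<exists>!k. k < nd \<and> S j i k = 1)"

definition Lag :: "real \<Rightarrow> real \<Rightarrow> real \<Rightarrow> nat \<Rightarrow> nat \<Rightarrow> nat \<Rightarrow> nat \<Rightarrow> nat \<Rightarrow>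
    (nat \<Rightarrow> real) \<Rightarrow> (nat \<Rightarrow> real) \<Rightarrow> cmat \<Rightarrow> cmat \<Rightarrow> cmat \<Rightarrow> cmat \<Rightarrow>
    cvec \<Rightarrow> cvec \<Rightarrow> cvec \<Rightarrow> cvec \<Rightarrow> cvec \<Rightarrow> cvec \<Rightarrow> cvec \<Rightarrow> cvec \<Rightarrow> cvec \<Rightarrow> real" where
  "Lag eps r eta n1 n2 nh m1 m2 f1 f2 A1 A2 P12 P21 u1 u2 v z1 z2 l12 l21 g1 g2 =
     G_eps eps m1 z1 f1 + G_eps eps m2 z2 f2
     + r * ((reip nh l12 (mv P12 nh n1 u1 - v) + nsq nh (mv P12 nh n1 u1 - v) / 2)
          + (reip nh l21 (mv P21 nh n2 u2 - v) + nsq nh (mv P21 nh n2 u2 - v) / 2))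
     + eta * ((reip m1 g1 (mv A1 m1 n1 u1 - z1) + nsq m1 (mv A1 m1 n1 u1 - z1) / 2)
          + (reip m2 g2 (mv A2 m2 n2 u2 - z2) + nsq m2 (mv A2 m2 n2 u2 - z2) / 2))"

text \<open>All real partial derivatives of F (a function of a vector in C^k, C^k
identified with R^{2k}) vanish at x, i.e. the real gradient of F at x is zero.\<close>
definition grad_zero :: "(cvec \<Rightarrow> real) \<Rightarrow> nat \<Rightarrow> cvec \<Rightarrow> bool" where
  "grad_zero F k x \<longleftrightarrow>
     (\<forall>j<k. \<forall>e\<in>{1, \<i>}. ((\<lambda>t::real. F (x(j := x j + complex_of_real t * e))) has_real_derivative 0) (at 0))"

definition stationary :: "(cvec \<Rightarrow> cvec \<Rightarrow> cvec \<Rightarrow> cvec \<Rightarrow> cvec \<Rightarrow> cvec \<Rightarrow> cvec \<Rightarrow> cvec \<Rightarrow> cvec \<Rightarrow> real)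
    \<Rightarrow> nat \<Rightarrow> nat \<Rightarrow> nat \<Rightarrow> nat \<Rightarrow> nat
    \<Rightarrow> cvec \<Rightarrow> cvec \<Rightarrow> cvec \<Rightarrow> cvec \<Rightarrow> cvec \<Rightarrow> cvec \<Rightarrow> cvec \<Rightarrow> cvec \<Rightarrow> cvec \<Rightarrow> bool" where
  "stationary Lf n1 n2 nh m1 m2 u1 u2 v z1 z2 l12 l21 g1 g2 \<longleftrightarrow>
     grad_zero (\<lambda>x. Lf x u2 v z1 z2 l12 l21 g1 g2) n1 u1 \<and>
     grad_zero (\<lambda>x. Lf u1 x v z1 z2 l12 l21 g1 g2) n2 u2 \<and>
     grad_zero (\<lambda>x. Lf u1 u2 x z1 z2 l12 l21 g1 g2) nh v \<and>
     grad_zero (\<lambda>x. Lf u1 u2 v x z2 l12 l21 g1 g2) m1 z1 \<and>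
     grad_zero (\<lambda>x. Lf u1 u2 v z1 x l12 l21 g1 g2) m2 z2 \<and>
     grad_zero (\<lambda>x. Lf u1 u2 v z1 z2 x l21 g1 g2) nh l12 \<and>
     grad_zero (\<lambda>x. Lf u1 u2 v z1 z2 l12 x g1 g2) nh l21 \<and>
     grad_zero (\<lambda>x. Lf u1 u2 v z1 z2 l12 l21 x g2) m1 g1 \<and>
     grad_zero (\<lambda>x. Lf u1 u2 v z1 z2 l12 l21 g1 x) m2 g2"

definition vconv :: "nat \<Rightarrow> (nat \<Rightarrow> cvec) \<Rightarrow> cvec \<Rightarrow> bool" where
  "vconv k xs x \<longleftrightarrow> (\<forall>j<k. (\<lambda>n. xs n j) \<longlonglongrightarrow> x j)"

definition limit_point :: "nat \<Rightarrow> nat \<Rightarrow> nat \<Rightarrow> nat \<Rightarrow> nat \<Rightarrow>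
    (nat \<Rightarrow> cvec) \<Rightarrow> (nat \<Rightarrow> cvec) \<Rightarrow> (nat \<Rightarrow> cvec) \<Rightarrow> (nat \<Rightarrow> cvec) \<Rightarrow> (nat \<Rightarrow> cvec) \<Rightarrow>
    (nat \<Rightarrow> cvec) \<Rightarrow> (nat \<Rightarrow> cvec) \<Rightarrow> (nat \<Rightarrow> cvec) \<Rightarrow> (nat \<Rightarrow> cvec) \<Rightarrow>
    cvec \<Rightarrow> cvec \<Rightarrow> cvec \<Rightarrow> cvec \<Rightarrow> cvec \<Rightarrow> cvec \<Rightarrow> cvec \<Rightarrow> cvec \<Rightarrow> cvec \<Rightarrow> bool" where
  "limit_point n1 n2 nh m1 m2 u1 u2 v z1 z2 l12 l21 g1 g2 us1 us2 vs zs1 zs2 ls12 ls21 gs1 gs2 \<longleftrightarrow>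
     (\<exists>\<phi>. strict_mono \<phi> \<and>
        vconv n1 (u1 \<circ> \<phi>) us1 \<and> vconv n2 (u2 \<circ> \<phi>) us2 \<and> vconv nh (v \<circ> \<phi>) vs \<and>
        vconv m1 (z1 \<circ> \<phi>) zs1 \<and> vconv m2 (z2 \<circ> \<phi>) zs2 \<and>
        vconv nh (l12 \<circ> \<phi>) ls12 \<and> vconv nh (l21 \<circ> \<phi>) ls21 \<and>
        vconv m1 (g1 \<circ> \<phi>) gs1 \<and> vconv m2 (g2 \<circ> \<phi>) gs2)"

end

theory Submission
  imports Defs "HOL-Analysis.Inner_Product" "HOL-Analysis.L2_Norm"
begin

text \<open>
  The metric is a concave quadratic plus a multiple of the squared distance to a disc, hence C^1 with
  curvature between -(1/eps - 1) and 1, and optimality in the z-step reads eta Gamma = grad G(z). The plain augmented Lagrangian is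
  not known to decrease under the given parameter conditions: bounding the ascent of the multiplier
  step directly costs a factor 1/r where the parameter set only controls 1/r^2. Instead one adds to it
  the squared steps of an ADMM contraction estimate,
  r/2 (|d(pi u)|^2 + |d Lambda|^2) + eta/2 |d(A u)|^2, obtained by testing the difference of two
  consecutive u-optimality conditions with the step of u; further multiples of |d(A u)|^2 and
  |d Gamma|^2 absorb the terms coming from the previous step. The ascent r |d Lambda|^2 is then
  cancelled, using only r > 2 eta |A* A| and the fact that pi is a coisometry. The remaining
  decrease controls |dz|^2 and |d(pi u)|^2. Along a subsequence converging to a limit point the energy
  is bounded below, so these steps tend to zero, and the optimality conditions pass to the limit.
\<close>

unbundle inner_syntax

section \<open>Weak convexity and smoothness of the metric\<close>

definition ball_proj :: "real \<Rightarrow> complex \<Rightarrow> complex" where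
  "ball_proj R x = (if cmod x < R then x else (R / cmod x) *\<^sub>R x)"

lemma norm_ball_proj_le:
  assumes "0 \<le> R" shows "cmod (ball_proj R x) \<le> R"
  using assms by (auto simp: ball_proj_def)

text \<open>Variational characterisation of the nearest point. Outside the disc the residual is a
  nonnegative multiple of \<open>x\<close>, and by Cauchy-Schwarz no point of the disc has a larger
  inner product with \<open>x\<close> than the projection.\<close>

lemma ball_proj_obtuse:
  assumes "0 \<le> R" "cmod a \<le> R"
  shows "(x - ball_proj R x) \<bullet> (a - ball_proj R x) \<le> 0"
proof (cases "cmod x < R")
  case True
  then show ?thesis by (simp add: ball_proj_def)
next
  case False
  show ?thesis
  proof (cases "x = 0")
    case True
    \<comment> \<open>Here \<open>R = 0\<close>, and the quotient by \<open>cmod x = 0\<close> only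
      scales the zero vector.\<close>
    then show ?thesis using False assms by (simp add: ball_proj_def)
  next
    case x: False
    define c where "c = R / cmod x"
    have c: "0 \<le> c" "c \<le> 1" "c * cmod x = R" using False x assms by (auto simp: c_def)
    have P: "ball_proj R x = c *\<^sub>R x" using False by (simp add: ball_proj_def c_def)
    have "x \<bullet> a \<le> cmod x * R"
      by (rule order_trans[OF norm_cauchy_schwarz]) (use assms in \<open>simp add: mult_left_mono\<close>)
    moreover have "x \<bullet> (c *\<^sub>R x) = cmod x * R"
      using c(3) by (simp add: dot_square_norm power2_eq_square)
    ultimately have "x \<bullet> (a - c *\<^sub>R x) \<le> 0" by (simp add: inner_diff_right)
    moreover have "(x - c *\<^sub>R x) \<bullet> (a - c *\<^sub>R x) = (1 - c) * (x \<bullet> (a - c *\<^sub>R x))"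
      by (simp add: inner_diff_left algebra_simps)
    ultimately show ?thesis using c P by (simp add: mult_nonneg_nonpos)
  qed
qed

text \<open>Sum of the two obtuse-angle inequalities at \<open>x\<close> and \<open>y\<close>. The
  residual is half the gradient of the squared distance, so this is firm nonexpansiveness of that
  half gradient.\<close>

lemma ball_proj_residual_firm:
  assumes "0 \<le> R"
  shows "(cmod ((x - ball_proj R x) - (y - ball_proj R y)))\<^sup>2
           \<le> ((x - ball_proj R x) - (y - ball_proj R y)) \<bullet> (x - y)"
  using ball_proj_obtuse[OF assms norm_ball_proj_le[OF assms, of y], of x]
    ball_proj_obtuse[OF assms norm_ball_proj_le[OF assms, of x], of y]
  unfolding cmod_power2 inner_complex_def by (simp add: power2_eq_square algebra_simps)

text \<open>The gap between the two sides is the square of the difference of the residuals plus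
  twice a nonnegative obtuse-angle term.\<close>

lemma ball_dist_sq_convex:
  assumes "0 \<le> R"
  shows "(cmod (y - ball_proj R y))\<^sup>2 + 2 * ((y - ball_proj R y) \<bullet> (x - y))
           \<le> (cmod (x - ball_proj R x))\<^sup>2"
proof -
  let ?a = "x - ball_proj R x" and ?b = "y - ball_proj R y"
  have "0 \<le> (cmod (?a - ?b))\<^sup>2" by simp
  then show ?thesis
    using ball_proj_obtuse[OF assms norm_ball_proj_le[OF assms, of x], of y]
    unfolding cmod_power2 inner_complex_def by (simp add: power2_eq_square algebra_simps)
qed

text \<open>The right side is the squared distance from \<open>x\<close> to
  \<open>ball_proj R y\<close>, a point of the disc, hence no smaller than the distance to the
  nearest point.\<close>

lemma ball_dist_sq_smooth:
  assumes "0 \<le> R"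
  shows "(cmod (x - ball_proj R x))\<^sup>2
           \<le> (cmod (y - ball_proj R y))\<^sup>2 + 2 * ((y - ball_proj R y) \<bullet> (x - y)) + (cmod (x - y))\<^sup>2"
proof -
  have "0 \<le> (cmod (ball_proj R x - ball_proj R y))\<^sup>2" by simp
  then show ?thesis
    using ball_proj_obtuse[OF assms norm_ball_proj_le[OF assms, of y], of x]
    unfolding cmod_power2 inner_complex_def by (simp add: power2_eq_square algebra_simps)
qed

section \<open>The metric and its gradient\<close>

definition g_grad :: "real \<Rightarrow> complex \<Rightarrow> real \<Rightarrow> complex" where
  "g_grad eps x b = x - (1 / eps) *\<^sub>R ball_proj (eps * sqrt b) x"

text \<open>Inside the disc the distance vanishes and the concave quadratic remains; outside, the
  distance is \<open>cmod x - eps * sqrt b\<close> and the squares recombine. The split replaces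
  case distinctions in all later estimates by properties of the projection.\<close>

lemma g_eps_eq_dist:
  assumes "0 < eps" "eps < 1" "0 \<le> b"
  shows "g_eps eps x b = (1 - eps) / 2 * b - (1 / eps - 1) / 2 * (cmod x)\<^sup>2
           + (cmod (x - ball_proj (eps * sqrt b) x))\<^sup>2 / (2 * eps)"
proof (cases "cmod x < eps * sqrt b")
  case True
  then show ?thesis using assms by (simp add: g_eps_def ball_proj_def field_simps)
next
  case False
  have "cmod (x - ball_proj (eps * sqrt b) x) = \<bar>cmod x - eps * sqrt b\<bar>"
  proof (cases "x = 0")
    case True
    then have "sqrt b = 0"
      using assms False by (auto simp: zero_less_mult_iff not_less intro: antisym)
    then show ?thesis using True by (simp add: ball_proj_def)
  next
    case x: False
    have "x - ball_proj (eps * sqrt b) x = (1 - eps * sqrt b / cmod x) *\<^sub>R x"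
      using False by (simp add: ball_proj_def algebra_simps)
    then have "cmod (x - ball_proj (eps * sqrt b) x) = \<bar>(1 - eps * sqrt b / cmod x) * cmod x\<bar>"
      by (simp add: abs_mult)
    also have "(1 - eps * sqrt b / cmod x) * cmod x = cmod x - eps * sqrt b"
      using x by (simp add: field_simps)
    finally show ?thesis .
  qed
  then have N: "(cmod (x - ball_proj (eps * sqrt b) x))\<^sup>2 = (cmod x - eps * sqrt b)\<^sup>2"
    by simp
  define s where "s = sqrt b"
  have s: "0 \<le> s" and b: "b = s\<^sup>2" using assms by (simp_all add: s_def)
  have g: "g_eps eps x b = (cmod x - s)\<^sup>2 / 2" using False by (simp add: g_eps_def s_def)
  show ?thesis
    unfolding g N unfolding s_def[symmetric] b
    using assms s by (simp add: field_simps power2_eq_square)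
qed

context
  fixes eps b :: real
  assumes eps: "0 < eps" "eps < 1" and b: "0 \<le> b"
begin

private lemma R: "0 \<le> eps * sqrt b"
  using eps b by simp

lemma g_grad_eq_residual:
  "g_grad eps x b = (1 / eps) *\<^sub>R (x - ball_proj (eps * sqrt b) x) - (1 / eps - 1) *\<^sub>R x"
  by (simp add: g_grad_def algebra_simps)

lemma g_eps_nonneg: "0 \<le> g_eps eps x b"
proof (cases "cmod x < eps * sqrt b")
  case True
  have "(cmod x)\<^sup>2 \<le> (eps * sqrt b)\<^sup>2" using True by (intro power_mono) auto
  also have "\<dots> = eps * (eps * b)" using b by (simp add: power2_eq_square)
  also have "\<dots> \<le> eps * b" using eps b by (simp add: mult_left_le_one_le mult_left_mono)
  finally have "(cmod x)\<^sup>2 / eps \<le> b" using eps by (simp add: field_simps)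
  then show ?thesis using True eps by (simp add: g_eps_def)
next
  case False
  then show ?thesis by (simp add: g_eps_def)
qed

text \<open>The distance part lies above its tangents, so only the concave quadratic loses, and it
  loses exactly its second-order term.\<close>

lemma g_eps_weakly_convex:
  "g_eps eps y b + g_grad eps y b \<bullet> (x - y) - (1 / eps - 1) / 2 * (cmod (x - y))\<^sup>2 \<le> g_eps eps x b"
proof -
  let ?P = "ball_proj (eps * sqrt b)" and ?k = "1 / eps - 1"
  have "1 / (2 * eps) * ((cmod (y - ?P y))\<^sup>2 + 2 * ((y - ?P y) \<bullet> (x - y)))
      \<le> 1 / (2 * eps) * (cmod (x - ?P x))\<^sup>2"
    using ball_dist_sq_convex[OF R, of y x] eps by (intro mult_left_mono) auto
  moreover have "k / 2 * (cmod x)\<^sup>2 - k / 2 * (cmod y)\<^sup>2 - k * (y \<bullet> (x - y)) = k / 2 * (cmod (x - y))\<^sup>2" for k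
    unfolding cmod_power2 inner_complex_def
    by (simp add: power2_eq_square algebra_simps add_divide_distrib diff_divide_distrib)
  from this[of ?k] have "?k / 2 * (cmod x)\<^sup>2 - ?k / 2 * (cmod y)\<^sup>2 - ?k * (y \<bullet> (x - y)) = ?k / 2 * (cmod (x - y))\<^sup>2" .
  ultimately show ?thesis
    unfolding g_eps_eq_dist[OF eps b] g_grad_eq_residual inner_diff_left inner_scaleR_left
    by (simp add: algebra_simps add_divide_distrib diff_divide_distrib)
qed

text \<open>Curvatures add: at most \<open>1 / eps\<close> from the distance part, minus
  \<open>1 / eps - 1\<close> from the quadratic, leaves 1.\<close>

lemma g_eps_smooth:
  "g_eps eps x b \<le> g_eps eps y b + g_grad eps y b \<bullet> (x - y) + (cmod (x - y))\<^sup>2 / 2"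
proof -
  let ?P = "ball_proj (eps * sqrt b)" and ?k = "1 / eps - 1"
  have "1 / (2 * eps) * (cmod (x - ?P x))\<^sup>2
     \<le> 1 / (2 * eps) * ((cmod (y - ?P y))\<^sup>2 + 2 * ((y - ?P y) \<bullet> (x - y)) + (cmod (x - y))\<^sup>2)"
    using ball_dist_sq_smooth[OF R, of x y] eps by (intro mult_left_mono) auto
  moreover have "k / 2 * (cmod x)\<^sup>2 - k / 2 * (cmod y)\<^sup>2 - k * (y \<bullet> (x - y)) = k / 2 * (cmod (x - y))\<^sup>2" for k
    unfolding cmod_power2 inner_complex_def
    by (simp add: power2_eq_square algebra_simps add_divide_distrib diff_divide_distrib)
  from this[of ?k] have "?k / 2 * (cmod x)\<^sup>2 - ?k / 2 * (cmod y)\<^sup>2 - ?k * (y \<bullet> (x - y)) = ?k / 2 * (cmod (x - y))\<^sup>2" .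
  ultimately show ?thesis
    unfolding g_eps_eq_dist[OF eps b] g_grad_eq_residual inner_diff_left inner_scaleR_left
    by (simp add: algebra_simps add_divide_distrib diff_divide_distrib)
qed

lemma g_grad_hypomonotone:
  "- (1 / eps - 1) * (cmod (x - y))\<^sup>2 \<le> (x - y) \<bullet> (g_grad eps x b - g_grad eps y b)"
proof -
  let ?P = "ball_proj (eps * sqrt b)"
  let ?t = "(x - ?P x) - (y - ?P y)"
  have "0 \<le> ?t \<bullet> (x - y)"
    by (rule order_trans[OF _ ball_proj_residual_firm[OF R]]) simp
  then have "0 \<le> (1 / eps) * (?t \<bullet> (x - y))" using eps by simp
  moreover have "g_grad eps x b - g_grad eps y b = (1 / eps) *\<^sub>R ?t - (1 / eps - 1) *\<^sub>R (x - y)"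
    unfolding g_grad_eq_residual by (simp add: algebra_simps)
  ultimately show ?thesis
    by (simp only: inner_diff_right[of _ "_ *\<^sub>R _"] inner_scaleR_right
        inner_commute[of "x - y" ?t] dot_square_norm)
qed

text \<open>The gradient difference is \<open>c t - (c - 1) d\<close> with \<open>t\<close> the
  difference of the residuals. Firm nonexpansiveness keeps \<open>t \<bullet> d\<close> between
  \<open>|t|^2\<close> and \<open>|d|^2\<close>, which gives this constant where the triangle
  inequality would give \<open>(2 / eps - 1)^2\<close>.\<close>

lemma g_grad_lipschitz:
  "(cmod (g_grad eps x b - g_grad eps y b))\<^sup>2 \<le> (1 + (1 / eps - 1)\<^sup>2) * (cmod (x - y))\<^sup>2"
proof -
  let ?P = "ball_proj (eps * sqrt b)"
  define t where "t = (x - ?P x) - (y - ?P y)"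
  define d where "d = x - y"
  define c where "c = 1 / eps"
  have c: "1 \<le> c" using eps by (simp add: c_def)
  have firm: "(cmod t)\<^sup>2 \<le> t \<bullet> d"
    unfolding t_def d_def by (rule ball_proj_residual_firm[OF R])
  have "0 \<le> (cmod (d - t))\<^sup>2" by simp
  then have td: "t \<bullet> d \<le> (cmod d)\<^sup>2"
    using firm unfolding cmod_power2 inner_complex_def
    by (simp add: power2_eq_square algebra_simps)
  have D: "g_grad eps x b - g_grad eps y b = c *\<^sub>R t - (c - 1) *\<^sub>R d"
    unfolding g_grad_eq_residual t_def d_def c_def by (simp add: algebra_simps)
  have "(cmod (g_grad eps x b - g_grad eps y b))\<^sup>2
      = c\<^sup>2 * (cmod t)\<^sup>2 - 2 * c * (c - 1) * (t \<bullet> d) + (c - 1)\<^sup>2 * (cmod d)\<^sup>2"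
    unfolding D cmod_power2 inner_complex_def by (simp add: power2_eq_square algebra_simps)
  also have "\<dots> \<le> c\<^sup>2 * (t \<bullet> d) - 2 * c * (c - 1) * (t \<bullet> d) + (c - 1)\<^sup>2 * (cmod d)\<^sup>2"
    using firm by (simp add: mult_left_mono)
  also have "\<dots> = (1 - (c - 1)\<^sup>2) * (t \<bullet> d) + (c - 1)\<^sup>2 * (cmod d)\<^sup>2"
    by (simp add: power2_eq_square algebra_simps)
  also have "\<dots> \<le> 1 * (t \<bullet> d) + (c - 1)\<^sup>2 * (cmod d)\<^sup>2"
    using order_trans[OF zero_le_power2 firm] by (intro add_right_mono mult_right_mono) auto
  also have "\<dots> \<le> (1 + (c - 1)\<^sup>2) * (cmod d)\<^sup>2"
    using td by (simp add: algebra_simps)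
  finally show ?thesis by (simp add: c_def d_def)
qed

lemma tendsto_g_grad:
  assumes "(X \<longlongrightarrow> x) F"
  shows "((\<lambda>n. g_grad eps (X n) b) \<longlongrightarrow> g_grad eps x b) F"
proof -
  define K where "K = sqrt (1 + (1 / eps - 1)\<^sup>2)"
  have K: "cmod (g_grad eps (X n) b - g_grad eps x b) \<le> K * cmod (X n - x)" for n
    using real_sqrt_le_mono[OF g_grad_lipschitz[of "X n" x]]
    by (simp add: K_def real_sqrt_mult)
  have "((\<lambda>n. X n - x) \<longlongrightarrow> 0) F" using assms by (rule LIM_zero)
  then have "((\<lambda>n. g_grad eps (X n) b - g_grad eps x b) \<longlongrightarrow> 0) F"
    by (rule tendsto_0_le[where K = K]) (use K in \<open>simp add: mult.commute\<close>)
  then show ?thesis by (rule LIM_zero_cancel)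
qed

end

section \<open>Coordinatewise energy estimates\<close>

text \<open>One coordinate of one subdomain: a prime marks the next iterate, the suffix
  \<open>m\<close> the previous one, \<open>y\<close> stands for A u, \<gamma> for Gamma, and
  \<kappa> for \<open>1 / eps - 1\<close>. In the rate, \<kappa>/2 comes from weak convexity and
  2\<kappa> from hypomonotonicity, which bounds the cross term of the steps of \<open>z\<close> and
  \<gamma>; the last term pays for the squared step of \<gamma> by the Lipschitz bound. The inner
  products with \<open>y' - y\<close> are left for u-optimality.\<close>

lemma block_energy_coordinate:
  fixes z z' \<gamma> \<gamma>' \<gamma>m y y' ym :: complex and G G' \<eta> \<kappa> :: real
  assumes \<eta>: "0 < \<eta>"
    and y: "y = z' + \<gamma>' - \<gamma>" and ym: "ym = z + \<gamma> - \<gamma>m"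
    and G: "G' - G \<le> \<eta> * (\<gamma>' \<bullet> (z' - z)) + \<kappa> / 2 * (cmod (z' - z))\<^sup>2"
    and mono: "- \<kappa> * (cmod (z' - z))\<^sup>2 \<le> \<eta> * ((z' - z) \<bullet> (\<gamma>' - \<gamma>))"
    and lip: "\<eta>\<^sup>2 * (cmod (\<gamma>' - \<gamma>))\<^sup>2 \<le> (1 + \<kappa>\<^sup>2) * (cmod (z' - z))\<^sup>2"
  shows "G' + \<eta> * (\<gamma>' \<bullet> (y' - z') + (cmod (y' - z'))\<^sup>2 / 2) + \<eta> * (cmod (y' - y))\<^sup>2 + \<eta> * (cmod (\<gamma>' - \<gamma>))\<^sup>2
     \<le> G + \<eta> * (\<gamma> \<bullet> (y - z) + (cmod (y - z))\<^sup>2 / 2) + \<eta> * (cmod (y - ym))\<^sup>2 + \<eta> * (cmod (\<gamma> - \<gamma>m))\<^sup>2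
       + \<eta> * ((y' + \<gamma>' - z') \<bullet> (y' - y))
       + (\<eta> * (((y' - y) - (z' - z) + (\<gamma>' - \<gamma>)) \<bullet> (y' - y))
          - \<eta> / 2 * (cmod ((y' - y) - (z' - z) + (\<gamma>' - \<gamma>)))\<^sup>2)
       - (\<eta> / 2 - 5 / 2 * \<kappa> - 2 * (1 + \<kappa>\<^sup>2) / \<eta>) * (cmod (z' - z))\<^sup>2"
proof -
  define D where "D = 2 * (1 + \<kappa>\<^sup>2) / \<eta>"
  have lip': "2 * \<eta> * (cmod (\<gamma>' - \<gamma>))\<^sup>2 \<le> D * (cmod (z' - z))\<^sup>2"
    using lip \<eta> by (simp add: D_def field_simps power2_eq_square)
  define Z H K V where "Z = z' - z" and "H = \<gamma>' - \<gamma>" and "K = \<gamma> - \<gamma>m" and "V = y' - y"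
  note ZHKV = Z_def[symmetric] H_def[symmetric] V_def[symmetric] K_def[symmetric]
  have e: "y' - z' = H + V" "y - z = Z + H" "y - ym = Z + H - K" "y' + \<gamma>' - z' = V + H + \<gamma>'"
    unfolding y ym Z_def H_def K_def V_def by simp_all
  have "\<gamma>' - H = \<gamma>" by (simp add: H_def)
  have "\<eta> * ((\<gamma>' - H) \<bullet> (Z + H) + (cmod (Z + H))\<^sup>2 / 2 + (cmod (Z + H - K))\<^sup>2 + (cmod K)\<^sup>2
      + (V + H + \<gamma>') \<bullet> V + (V - Z + H) \<bullet> V - (cmod (V - Z + H))\<^sup>2 / 2
      - (\<gamma>' \<bullet> (H + V) + (cmod (H + V))\<^sup>2 / 2 + (cmod V)\<^sup>2 + (cmod H)\<^sup>2))
    = \<eta> * (\<gamma>' \<bullet> Z + (cmod Z)\<^sup>2 / 2 + 2 * (Z \<bullet> H) - 2 * (cmod H)\<^sup>2 + (cmod (Z + H - 2 *\<^sub>R K))\<^sup>2 / 2)"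
    unfolding power2_norm_eq_inner
    by (simp add: inner_add_left inner_add_right inner_diff_left inner_diff_right
        inner_commute algebra_simps add_divide_distrib diff_divide_distrib)
  moreover have "0 \<le> \<eta> * ((cmod (Z + H - 2 *\<^sub>R K))\<^sup>2 / 2)"
    using \<eta> by simp
  ultimately show ?thesis
    using G mono lip' unfolding e ZHKV D_def[symmetric] \<open>\<gamma>' - H = \<gamma>\<close>
    by (simp only: distrib_left right_diff_distrib left_diff_distrib mult.assoc times_divide_eq_left)
qed

text \<open>One coordinate of the overlap, with \<open>p\<close> for pi u and \<open>l\<close> for
  Lambda. After eliminating dependent variables the difference of the two sides is an exact sum of
  three squares. The bracketed terms on the right are those that the subdomain estimates cancel, up
  to the decrease in the steps of \<open>p\<close>.\<close>

lemma consensus_energy_coordinate: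
  fixes p1 p1' p1m p2 p2' p2m l1 l1' l1m l2 l2' l2m v v' :: complex
  assumes v': "2 * v' = (p1 + l1) + (p2 + l2)" and v: "2 * v = (p1m + l1m) + (p2m + l2m)"
    and l1': "l1' = l1 + p1' - v'" and l2': "l2' = l2 + p2' - v'"
    and l1: "l1 = l1m + p1 - v" and l2: "l2 = l2m + p2 - v"
  shows "(l1' \<bullet> (p1' - v') + (cmod (p1' - v'))\<^sup>2 / 2) + (l2' \<bullet> (p2' - v') + (cmod (p2' - v'))\<^sup>2 / 2)
      + ((cmod (p1' - p1))\<^sup>2 + (cmod (l1' - l1))\<^sup>2 + (cmod (p2' - p2))\<^sup>2 + (cmod (l2' - l2))\<^sup>2) / 2
    \<le> (l1 \<bullet> (p1 - v) + (cmod (p1 - v))\<^sup>2 / 2) + (l2 \<bullet> (p2 - v) + (cmod (p2 - v))\<^sup>2 / 2)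
      + ((cmod (p1 - p1m))\<^sup>2 + (cmod (l1 - l1m))\<^sup>2 + (cmod (p2 - p2m))\<^sup>2 + (cmod (l2 - l2m))\<^sup>2) / 2
      + (l1' \<bullet> (p1' - p1) + (l1' - l1) \<bullet> (p1' - p1) + (cmod (l1' - l1))\<^sup>2 - (cmod (p1' - p1))\<^sup>2 / 2)
      + (l2' \<bullet> (p2' - p2) + (l2' - l2) \<bullet> (p2' - p2) + (cmod (l2' - l2))\<^sup>2 - (cmod (p2' - p2))\<^sup>2 / 2)"
proof -
  define M1 M2 N1 N2 Q1 Q2 D where "M1 = l1' - l1" and "M2 = l2' - l2" and "N1 = l1 - l1m"
    and "N2 = l2 - l2m" and "Q1 = p1 - p1m" and "Q2 = p2 - p2m" and "D = v' - v"
  note defs = M1_def M2_def N1_def N2_def Q1_def Q2_def D_def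
  have d: "p1' - v' = M1" "p2' - v' = M2" "p1 - v = N1" "p2 - v = N2"
    "l1' - l1 = M1" "l2' - l2 = M2" "l1 - l1m = N1" "l2 - l2m = N2" "p1 - p1m = Q1" "p2 - p2m = Q2"
    using l1' l2' l1 l2 by (simp_all add: defs)
  have P: "p1' - p1 = M1 - N1 + D" "p2' - p2 = M2 - N2 + D"
    using l1' l2' l1 l2 by (simp_all add: defs)
  have l: "l1 = l1' - M1" "l2 = l2' - M2" by (simp_all add: defs)
  have "Q2 = (p1 + l1 + p2 + l2) - (p1m + l1m + p2m + l2m) - N1 - N2 - Q1"
    by (simp add: defs)
  also have "\<dots> = 2 * v' - 2 * v - N1 - N2 - Q1"
    unfolding v v' by (simp add: algebra_simps)
  finally have Q2: "Q2 = D + D - N1 - N2 - Q1"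
    by (simp add: D_def algebra_simps)
  \<comment> \<open>Adding both multiplier updates and inserting the average \<open>v'\<close>: the
    new multipliers sum to the steps of \<open>p1\<close> and \<open>p2\<close>.\<close>
  have "l1' + l2' = (l1 + l2 + p1' + p2') - 2 * v'"
    using l1' l2' by simp
  also have "\<dots> = (M1 - N1 + D) + (M2 - N2 + D)"
    unfolding v' P[symmetric] by simp
  finally have l': "l2' = (M1 - N1 + D) + (M2 - N2 + D) - l1'"
    by (simp add: eq_diff_eq add.commute)
  have "(l1 \<bullet> N1 + (cmod N1)\<^sup>2 / 2) + (l2 \<bullet> N2 + (cmod N2)\<^sup>2 / 2)
      + ((cmod Q1)\<^sup>2 + (cmod N1)\<^sup>2 + (cmod Q2)\<^sup>2 + (cmod N2)\<^sup>2) / 2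
      + (l1' \<bullet> (M1 - N1 + D) + M1 \<bullet> (M1 - N1 + D) + (cmod M1)\<^sup>2 - (cmod (M1 - N1 + D))\<^sup>2 / 2)
      + (l2' \<bullet> (M2 - N2 + D) + M2 \<bullet> (M2 - N2 + D) + (cmod M2)\<^sup>2 - (cmod (M2 - N2 + D))\<^sup>2 / 2)
    = (l1' \<bullet> M1 + (cmod M1)\<^sup>2 / 2) + (l2' \<bullet> M2 + (cmod M2)\<^sup>2 / 2)
      + ((cmod (M1 - N1 + D))\<^sup>2 + (cmod M1)\<^sup>2 + (cmod (M2 - N2 + D))\<^sup>2 + (cmod M2)\<^sup>2) / 2
      + ((cmod (D - Q1))\<^sup>2 / 2 + (cmod (D - Q2))\<^sup>2 / 2 + (cmod D)\<^sup>2)"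
    unfolding l l' Q2 power2_norm_eq_inner inner_add_left inner_add_right inner_diff_left inner_diff_right
    by (simp add: inner_commute add_divide_distrib diff_divide_distrib)
  moreover have "0 \<le> (cmod (D - Q1))\<^sup>2 / 2 + (cmod (D - Q2))\<^sup>2 / 2 + (cmod D)\<^sup>2"
    by simp
  ultimately show ?thesis
    unfolding d P by linarith
qed

section \<open>Complex vectors and operator norms\<close>

text \<open>Turns minimality into an optimality condition without differentiation: at
  \<open>t = - D / c\<close> with \<open>c\<close> larger than \<open>C\<close>, the linear term
  outweighs the quadratic one.\<close>

lemma first_order_coefficient_zero:
  fixes D C :: real
  assumes "\<And>t::real. 0 \<le> t * D + t\<^sup>2 * C"
  shows "D = 0"
proof (rule ccontr)
  assume D: "D \<noteq> 0"
  define c where "c = \<bar>C\<bar> + 1"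
  have c: "0 < c" "C < c" by (auto simp: c_def)
  have "0 \<le> (- D / c) * D + (- D / c)\<^sup>2 * C" by (rule assms)
  also have "\<dots> = D\<^sup>2 * (C - c) / c\<^sup>2"
    using c(1) by (simp add: field_simps power2_eq_square)
  also have "\<dots> < 0"
    using c D by (simp add: divide_less_0_iff mult_less_0_iff)
  finally show False by simp
qed

lemma reip_inner: "reip k a b = (\<Sum>j<k. a j \<bullet> b j)"
  by (simp add: reip_def inner_complex_def)

lemma nsq_nonneg [simp]: "0 \<le> nsq k x"
  by (simp add: nsq_def sum_nonneg)

lemma reip_cong: "(\<And>j. j < k \<Longrightarrow> a j = a' j) \<Longrightarrow> (\<And>j. j < k \<Longrightarrow> b j = b' j) \<Longrightarrow> reip k a b = reip k a' b'"
  by (simp add: reip_def)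

lemma reip_self: "reip k x x = nsq k x"
  by (simp add: reip_inner nsq_def dot_square_norm)

lemma reip_diff_left: "reip k (a - b) c = reip k a c - reip k b c"
  by (simp add: reip_inner inner_diff_left sum_subtractf)

lemma nsq_eq_0_iff: "nsq k x = 0 \<longleftrightarrow> (\<forall>j<k. x j = 0)"
  by (simp add: nsq_def sum_nonneg_eq_0_iff) auto

lemma cmod_add_real_mult_sq:
  "(cmod (a + complex_of_real t * b))\<^sup>2 = (cmod a)\<^sup>2 + t * (2 * (a \<bullet> b)) + t\<^sup>2 * (cmod b)\<^sup>2"
  unfolding cmod_power2 inner_complex_def by (simp add: power2_eq_square algebra_simps)

lemma nsq_add_real_mult:
  "nsq k (\<lambda>j. a j + complex_of_real t * b j) = nsq k a + t * (2 * reip k a b) + t\<^sup>2 * nsq k b"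
  by (simp add: nsq_def reip_inner cmod_add_real_mult_sq sum.distrib sum_distrib_left)

lemma vnorm_eq_L2_set: "vnorm k x = L2_set (\<lambda>j. cmod (x j)) {..<k}"
  by (simp add: vnorm_def nsq_def L2_set_def)

lemma vnorm_power2 [simp]: "(vnorm k x)\<^sup>2 = nsq k x"
  by (simp add: vnorm_def)

lemma abs_reip_le: "\<bar>reip k a b\<bar> \<le> vnorm k a * vnorm k b"
proof -
  have "\<bar>reip k a b\<bar> \<le> (\<Sum>j<k. \<bar>cmod (a j)\<bar> * \<bar>cmod (b j)\<bar>)"
    unfolding reip_inner
    by (rule order_trans[OF sum_abs sum_mono]) (simp add: Cauchy_Schwarz_ineq2)
  also have "\<dots> \<le> vnorm k a * vnorm k b"
    unfolding vnorm_eq_L2_set by (rule L2_set_mult_ineq)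
  finally show ?thesis .
qed

lemma mv_add_mult: "mv M r c (\<lambda>i. x i + t * d i) = (\<lambda>i. mv M r c x i + t * mv M r c d i)"
  by (auto simp: mv_def sum.distrib sum_distrib_left algebra_simps)

lemma mv_diff: "mv M r c (x - y) = mv M r c x - mv M r c y"
  by (auto simp: mv_def fun_eq_iff sum_subtractf algebra_simps)

lemma mv_scale: "mv M r c (\<lambda>i. t * x i) = (\<lambda>i. t * mv M r c x i)"
  by (auto simp: mv_def sum_distrib_left algebra_simps)

lemma reip_mv_adj: "reip r (mv M r c x) y = reip c x (mv (adj M) c r y)"
proof -
  have "(\<Sum>j<r. (\<Sum>k<c. M j k * x k) * cnj (y j)) = (\<Sum>j<r. \<Sum>k<c. x k * cnj (cnj (M j k) * y j))"
    by (simp add: sum_distrib_left sum_distrib_right mult_ac)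
  also have "\<dots> = (\<Sum>k<c. x k * cnj (\<Sum>j<r. cnj (M j k) * y j))"
    by (subst sum.swap) (simp add: sum_distrib_left)
  finally show ?thesis by (simp add: reip_def mv_def adj_def)
qed

lemma mv_mm: "i < r \<Longrightarrow> mv (mm M N q) r c x i = mv M r q (mv N q c x) i"
  by (simp add: mv_def mm_def sum_distrib_left sum_distrib_right mult.assoc sum.swap[of _ "{..<c}"])

text \<open>\<open>opnorm\<close> is a real supremum, so it says something only once the set is
  bounded; the sum of all moduli of entries is a bound. The rest is scaling to unit norm.\<close>

lemma vnorm_mv_le_opnorm: "vnorm r (mv M r c x) \<le> opnorm M r c * vnorm c x"
proof -
  let ?S = "{vnorm r (mv M r c x) | x. vnorm c x \<le> 1}"
  have "vnorm r (mv M r c x) \<le> (\<Sum>i<r. \<Sum>k<c. cmod (M i k))" if x: "vnorm c x \<le> 1" for x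
  proof -
    have "cmod (x k) \<le> 1" if "k < c" for k
      using member_le_L2_set[of "{..<c}" k "\<lambda>j. cmod (x j)"] x that by (simp add: vnorm_eq_L2_set)
    then have "cmod (mv M r c x i) \<le> (\<Sum>k<c. cmod (M i k))" if "i < r" for i
      using that by (simp add: mv_def) (intro order_trans[OF norm_sum sum_mono], simp add: norm_mult mult_left_le)
    then have "(\<Sum>i<r. cmod (mv M r c x i)) \<le> (\<Sum>i<r. \<Sum>k<c. cmod (M i k))"
      by (intro sum_mono) auto
    then show ?thesis
      unfolding vnorm_eq_L2_set by (intro order_trans[OF L2_set_le_sum]) auto
  qed
  then have bdd: "bdd_above ?S" by (intro bdd_aboveI) auto
  show ?thesis
  proof (cases "vnorm c x = 0")
    case True
    then have "x k = 0" if "k < c" for k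
      using that nsq_eq_0_iff[of c x] by (simp add: vnorm_def)
    then have "nsq r (mv M r c x) = 0" by (simp add: nsq_eq_0_iff mv_def)
    then show ?thesis using True by (simp add: vnorm_def)
  next
    case False
    then have pos: "0 < vnorm c x" by (simp add: vnorm_def less_le)
    define y where "y = (\<lambda>i. complex_of_real (1 / vnorm c x) * x i)"
    have sc: "vnorm k (\<lambda>i. complex_of_real s * w i) = \<bar>s\<bar> * vnorm k w" for k s w
      by (simp add: vnorm_def nsq_def norm_mult power_mult_distrib sum_distrib_left[symmetric] real_sqrt_mult)
    have "vnorm c y = 1" using pos by (simp add: y_def sc del: of_real_divide)
    then have "vnorm r (mv M r c y) \<le> opnorm M r c"
      unfolding opnorm_def by (intro cSup_upper bdd) auto
    moreover have "vnorm r (mv M r c y) = vnorm r (mv M r c x) / vnorm c x"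
      using pos by (simp add: y_def mv_scale sc del: of_real_divide)
    ultimately show ?thesis using pos by (simp add: field_simps)
  qed
qed

text \<open>Moving \<open>M\<close> across the inner product gives the quadratic form of the Gram
  matrix, to which Cauchy-Schwarz applies. This matches the norm of A* A in the parameter
  set.\<close>

lemma nsq_mv_le_opnorm_gram:
  "nsq r (mv M r c x) \<le> opnorm (mm (adj M) M r) c c * nsq c x"
proof -
  have "nsq r (mv M r c x) = reip c x (mv (mm (adj M) M r) c c x)"
    unfolding reip_self[symmetric] reip_mv_adj by (intro reip_cong refl) (simp add: mv_mm)
  also have "\<dots> \<le> vnorm c x * vnorm c (mv (mm (adj M) M r) c c x)"
    using abs_reip_le by (rule order_trans[OF abs_ge_self])
  also have "\<dots> \<le> vnorm c x * (opnorm (mm (adj M) M r) c c * vnorm c x)"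
    by (intro mult_left_mono vnorm_mv_le_opnorm) (simp add: vnorm_def)
  also have "\<dots> = opnorm (mm (adj M) M r) c c * nsq c x"
    unfolding vnorm_power2[symmetric] by (simp add: power2_eq_square)
  finally show ?thesis .
qed

section \<open>One subdomain\<close>

text \<open>The rate of \<open>block_energy_coordinate\<close> at \<kappa> =
  \<open>1 / eps - 1\<close>.\<close>

definition decay_rate :: "real \<Rightarrow> real \<Rightarrow> real" where
  "decay_rate eps eta = eta / 2 - 5 / 2 * (1 / eps - 1) - 2 * (1 + (1 / eps - 1)\<^sup>2) / eta"

text \<open>The sequence \<open>v\<close> is arbitrary here, since its update couples the two
  subdomains; \<open>od2p\<close> adds that update. The last assumption asks for norm-preserving
  preimages under \<open>P\<close>, the form in which the coisometry property is applied.\<close>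

locale od2p_block =
  fixes eps eta r :: real and nd nh m :: nat and A P :: cmat and f :: "nat \<Rightarrow> real"
    and u z g l v :: "nat \<Rightarrow> cvec"
  assumes eps: "0 < eps" "eps < 1" and r: "0 < r" and eta: "0 < eta"
    and f: "\<forall>j<m. 0 \<le> f j"
    and z_step: "\<forall>k. \<forall>x. G_eps eps m (z (Suc k)) f + eta / 2 * nsq m (z (Suc k) - (g k + mv A m nd (u k)))
                     \<le> G_eps eps m x f + eta / 2 * nsq m (x - (g k + mv A m nd (u k)))"
    and g_step: "\<forall>k. veq m (g (Suc k)) (g k + mv A m nd (u k) - z (Suc k))"
    and u_step: "\<forall>k. \<forall>x. eta / 2 * nsq m (mv A m nd (u (Suc k)) + g (Suc k) - z (Suc k))
                          + r / 2 * nsq nh (mv P nh nd (u (Suc k)) - v (Suc k) + l k)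
                     \<le> eta / 2 * nsq m (mv A m nd x + g (Suc k) - z (Suc k))
                          + r / 2 * nsq nh (mv P nh nd x - v (Suc k) + l k)"
    and l_step: "\<forall>k. veq nh (l (Suc k)) (l k + mv P nh nd (u (Suc k)) - v (Suc k))"
    and dominance: "2 * eta * opnorm (mm (adj A) A m) nd nd < r"
    and P_coisometry: "\<And>x. \<exists>h. veq nh (mv P nh nd h) x \<and> nsq nd h = nsq nh x"
begin

definition y :: "nat \<Rightarrow> cvec" where "y k = mv A m nd (u k)"

definition p :: "nat \<Rightarrow> cvec" where "p k = mv P nh nd (u k)"

lemma y_eq: "j < m \<Longrightarrow> y k j = z (Suc k) j + g (Suc k) j - g k j"
  using g_step by (simp add: veq_def y_def)

lemma l_Suc: "j < nh \<Longrightarrow> l (Suc k) j = l k j + p (Suc k) j - v (Suc k) j"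
  using l_step by (simp add: veq_def p_def)

text \<open>Optimality in the z-step, where the multiplier update turns the gradient of the
  quadratic term into the new Gamma.\<close>

lemma g_grad_z:
  assumes j: "j < m" shows "g_grad eps (z (Suc k) j) (f j) = eta *\<^sub>R g (Suc k) j"
proof -
  let ?z = "z (Suc k)" and ?s = "g k + mv A m nd (u k)"
  \<comment> \<open>\<open>d\<close> is the gradient of the z-objective at the minimizer. Moving
    along \<open>d\<close> itself makes the linear coefficient \<open>nsq m d\<close>; the quadratic
    one comes from the upper bound \<open>g_eps_smooth\<close>.\<close>
  define d where "d = (\<lambda>j. g_grad eps (?z j) (f j) + eta *\<^sub>R (?z j - ?s j))"
  have "0 \<le> t * nsq m d + t\<^sup>2 * ((1 + eta) / 2 * nsq m d)" for t
  proof -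
    define x where "x = (\<lambda>j. ?z j + complex_of_real t * d j)"
    have "G_eps eps m x f \<le> (\<Sum>j<m. g_eps eps (?z j) (f j) + t * (g_grad eps (?z j) (f j) \<bullet> d j)
        + t\<^sup>2 * (cmod (d j))\<^sup>2 / 2)"
      unfolding G_eps_def
    proof (intro sum_mono)
      fix j assume "j \<in> {..<m}"
      then have "g_eps eps (x j) (f j) \<le> g_eps eps (?z j) (f j)
          + g_grad eps (?z j) (f j) \<bullet> (x j - ?z j) + (cmod (x j - ?z j))\<^sup>2 / 2"
        using f by (intro g_eps_smooth eps) auto
      moreover have "x j - ?z j = t *\<^sub>R d j" by (simp add: x_def scaleR_conv_of_real)
      ultimately show "g_eps eps (x j) (f j) \<le> g_eps eps (?z j) (f j) + t * (g_grad eps (?z j) (f j) \<bullet> d j)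
        + t\<^sup>2 * (cmod (d j))\<^sup>2 / 2"
        by (simp add: power_mult_distrib)
    qed
    also have "\<dots> = G_eps eps m ?z f + t * (\<Sum>j<m. g_grad eps (?z j) (f j) \<bullet> d j) + t\<^sup>2 * (nsq m d / 2)"
      by (simp add: sum.distrib G_eps_def nsq_def sum_distrib_left sum_divide_distrib)
    finally have G: "G_eps eps m x f \<le> \<dots>" .
    have "x - ?s = (\<lambda>j. (?z - ?s) j + complex_of_real t * d j)"
      by (simp add: x_def fun_eq_iff)
    then have N: "nsq m (x - ?s) = nsq m (?z - ?s) + t * (2 * reip m (?z - ?s) d) + t\<^sup>2 * nsq m d"
      by (simp only: nsq_add_real_mult)
    have "nsq m d = (\<Sum>j<m. g_grad eps (?z j) (f j) \<bullet> d j) + eta * reip m (?z - ?s) d"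
      unfolding reip_self[symmetric] reip_inner
      by (simp add: d_def inner_add_left sum.distrib sum_distrib_left)
    then have "t * nsq m d = t * (\<Sum>j<m. g_grad eps (?z j) (f j) \<bullet> d j) + eta * t * reip m (?z - ?s) d"
      by (simp add: algebra_simps)
    then show ?thesis
      using G z_step[rule_format, of k x] unfolding N
      by (simp add: algebra_simps add_divide_distrib)
  qed
  then have "nsq m d = 0" by (rule first_order_coefficient_zero)
  then have "d j = 0" using j by (simp add: nsq_eq_0_iff)
  then have "g_grad eps (?z j) (f j) = eta *\<^sub>R (?s j - ?z j)"
    by (simp add: d_def scaleR_diff_right eq_neg_iff_add_eq_0[symmetric])
  moreover have "?s j - ?z j = g (Suc k) j"
    using y_eq[OF j, of k] by (simp add: y_def)
  ultimately show ?thesis by simp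
qed

text \<open>First variation of the u-step in direction \<open>h\<close>; the multiplier update
  absorbs the second residual into the new Lambda.\<close>

lemma u_optimality:
  "eta * reip m (y (Suc k) + g (Suc k) - z (Suc k)) (mv A m nd h) + r * reip nh (l (Suc k)) (mv P nh nd h) = 0"
proof (rule first_order_coefficient_zero)
  fix t :: real
  let ?a = "y (Suc k) + g (Suc k) - z (Suc k)" and ?b = "p (Suc k) - v (Suc k) + l k"
  let ?x = "\<lambda>i. u (Suc k) i + complex_of_real t * h i"
  have "mv A m nd ?x + g (Suc k) - z (Suc k) = (\<lambda>j. ?a j + complex_of_real t * mv A m nd h j)"
    and "mv P nh nd ?x - v (Suc k) + l k = (\<lambda>j. ?b j + complex_of_real t * mv P nh nd h j)"
    by (simp_all add: mv_add_mult y_def p_def fun_eq_iff)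
  then have "eta / 2 * nsq m ?a + r / 2 * nsq nh ?b
     \<le> eta / 2 * (nsq m ?a + t * (2 * reip m ?a (mv A m nd h)) + t\<^sup>2 * nsq m (mv A m nd h))
       + r / 2 * (nsq nh ?b + t * (2 * reip nh ?b (mv P nh nd h)) + t\<^sup>2 * nsq nh (mv P nh nd h))"
    using u_step[rule_format, of k ?x] by (simp only: nsq_add_real_mult y_def p_def)
  moreover have "reip nh ?b (mv P nh nd h) = reip nh (l (Suc k)) (mv P nh nd h)"
    by (intro reip_cong) (simp_all add: l_Suc)
  ultimately show "0 \<le> t * (eta * reip m ?a (mv A m nd h) + r * reip nh (l (Suc k)) (mv P nh nd h))
     + t\<^sup>2 * (eta / 2 * nsq m (mv A m nd h) + r / 2 * nsq nh (mv P nh nd h))"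
    by (simp add: algebra_simps)
qed

text \<open>
  The increment of A u + Gamma - z, i.e. of the residual in the u-optimality condition.
\<close>

definition residual :: "nat \<Rightarrow> cvec" where
  "residual k = (y (Suc k) - y k) - (z (Suc k) - z k) + (g (Suc k) - g k)"

lemma u_optimality_diff:
  "eta * reip m (residual (Suc k)) (mv A m nd h) + r * reip nh (l (Suc (Suc k)) - l (Suc k)) (mv P nh nd h) = 0"
proof -
  have "residual (Suc k) = (y (Suc (Suc k)) + g (Suc (Suc k)) - z (Suc (Suc k))) - (y (Suc k) + g (Suc k) - z (Suc k))"
    by (simp add: residual_def)
  then show ?thesis
    using u_optimality[of "Suc k" h] u_optimality[of k h]
    by (simp only: reip_diff_left right_diff_distrib)
qed

text \<open>Test the difference of the optimality conditions with a preimage \<open>h\<close> of the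
  Lambda step of equal norm. Cauchy-Schwarz and the Gram bound give
  \<open>r^2 |dLambda|^2 \<le> eta^2 |A* A| |residual|^2\<close>, and \<open>dominance\<close>
  trades \<open>eta |A* A|\<close> for \<open>r / 2\<close>.\<close>

lemma dual_step_bound:
  "r * nsq nh (l (Suc (Suc k)) - l (Suc k)) \<le> eta / 2 * nsq m (residual (Suc k))"
proof -
  let ?x = "l (Suc (Suc k)) - l (Suc k)" and ?w = "residual (Suc k)"
  let ?D = "opnorm (mm (adj A) A m) nd nd"
  obtain h where h: "veq nh (mv P nh nd h) ?x" and hn: "nsq nd h = nsq nh ?x"
    using P_coisometry by blast
  show ?thesis
  proof (cases "nsq nh ?x = 0")
    case True
    then show ?thesis using eta by simp
  next
    case False
    then have pos: "0 < nsq nh ?x" by (simp add: less_le)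
    have "reip nh ?x (mv P nh nd h) = nsq nh ?x"
      unfolding reip_self[symmetric] using h by (intro reip_cong) (auto simp: veq_def)
    then have "r * nsq nh ?x = - (eta * reip m ?w (mv A m nd h))"
      using u_optimality_diff[of k h] by simp
    then have "\<bar>r * nsq nh ?x\<bar> = eta * \<bar>reip m ?w (mv A m nd h)\<bar>"
      using eta by (simp add: abs_mult)
    also have "\<dots> \<le> eta * (vnorm m ?w * vnorm m (mv A m nd h))"
      using eta by (intro mult_left_mono abs_reip_le) auto
    finally have "(r * nsq nh ?x)\<^sup>2 \<le> (eta * (vnorm m ?w * vnorm m (mv A m nd h)))\<^sup>2"
      by (rule abs_le_square_iff[THEN iffD1, OF order_trans[OF _ abs_ge_self]])
    also have "\<dots> = eta\<^sup>2 * (nsq m ?w * nsq m (mv A m nd h))"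
      by (simp add: power_mult_distrib)
    also have "\<dots> \<le> eta\<^sup>2 * (nsq m ?w * (?D * nsq nh ?x))"
      using nsq_mv_le_opnorm_gram[of m A nd h] by (intro mult_left_mono) (auto simp: hn)
    finally have "r\<^sup>2 * nsq nh ?x * nsq nh ?x \<le> eta\<^sup>2 * nsq m ?w * ?D * nsq nh ?x"
      by (simp add: power2_eq_square mult_ac)
    then have "r\<^sup>2 * nsq nh ?x \<le> eta\<^sup>2 * nsq m ?w * ?D"
      using pos by (simp add: mult_le_cancel_right)
    also have "\<dots> = (eta / 2 * nsq m ?w) * (2 * eta * ?D)"
      by (simp add: power2_eq_square)
    also have "\<dots> \<le> (eta / 2 * nsq m ?w) * r"
      using dominance eta by (intro mult_left_mono) auto
    finally have "(r * nsq nh ?x) * r \<le> (eta / 2 * nsq m ?w) * r"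
      by (simp add: power2_eq_square mult_ac)
    then show ?thesis using r by (rule mult_right_le_imp_le)
  qed
qed

text \<open>
  Index k refers to the iterate k + 1, so that the step from k to k + 1 is available without
  truncated subtraction.
\<close>

definition energy :: "nat \<Rightarrow> real" where
  "energy k = (\<Sum>j<m. g_eps eps (z (Suc k) j) (f j)
     + eta * (g (Suc k) j \<bullet> (y (Suc k) j - z (Suc k) j) + (cmod (y (Suc k) j - z (Suc k) j))\<^sup>2 / 2)
     + eta * (cmod (y (Suc k) j - y k j))\<^sup>2 + eta * (cmod (g (Suc k) j - g k j))\<^sup>2)"

text \<open>By \<open>g_grad_z\<close> the multiplier is a multiple of the gradient of the metric at
  \<open>z\<close>, so its steps inherit the Lipschitz bound.\<close>

lemma g_Suc_diff_le:
  assumes j: "j < m"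
  shows "eta\<^sup>2 * (cmod (g (Suc (Suc k)) j - g (Suc k) j))\<^sup>2
           \<le> (1 + (1 / eps - 1)\<^sup>2) * (cmod (z (Suc (Suc k)) j - z (Suc k) j))\<^sup>2"
proof -
  have "g_grad eps (z (Suc (Suc k)) j) (f j) - g_grad eps (z (Suc k) j) (f j)
      = eta *\<^sub>R (g (Suc (Suc k)) j - g (Suc k) j)"
    by (simp add: g_grad_z[OF j] scaleR_diff_right)
  moreover have "0 \<le> f j" using f j by blast
  ultimately show ?thesis
    using g_grad_lipschitz[OF eps, of "f j" "z (Suc (Suc k)) j" "z (Suc k) j"]
    by (simp add: power_mult_distrib)
qed

text \<open>Sums the coordinate estimate and tests with the step of \<open>u\<close>:
  \<open>u_optimality\<close> and \<open>u_optimality_diff\<close> convert the inner products with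
  the step of A u into overlap terms, and \<open>dual_step_bound\<close> converts the negative
  square of the residual. The overlap terms are those of the consensus estimate with opposite
  sign.\<close>

lemma energy_descent:
  "energy (Suc k) \<le> energy k
     - r * reip nh (l (Suc (Suc k))) (p (Suc (Suc k)) - p (Suc k))
     - r * reip nh (l (Suc (Suc k)) - l (Suc k)) (p (Suc (Suc k)) - p (Suc k))
     - r * nsq nh (l (Suc (Suc k)) - l (Suc k))
     - decay_rate eps eta * nsq m (z (Suc (Suc k)) - z (Suc k))"
proof -
  let ?u = "u (Suc (Suc k)) - u (Suc k)"
  have Au: "mv A m nd ?u = y (Suc (Suc k)) - y (Suc k)" and Pu: "mv P nh nd ?u = p (Suc (Suc k)) - p (Suc k)"
    by (simp_all add: mv_diff y_def p_def)
  let ?a = "y (Suc (Suc k)) + g (Suc (Suc k)) - z (Suc (Suc k))" and ?d = "y (Suc (Suc k)) - y (Suc k)"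
  have "energy (Suc k) \<le> (\<Sum>j<m. (g_eps eps (z (Suc k) j) (f j)
     + eta * (g (Suc k) j \<bullet> (y (Suc k) j - z (Suc k) j) + (cmod (y (Suc k) j - z (Suc k) j))\<^sup>2 / 2)
     + eta * (cmod (y (Suc k) j - y k j))\<^sup>2 + eta * (cmod (g (Suc k) j - g k j))\<^sup>2)
     + eta * (?a j \<bullet> ?d j) + (eta * (residual (Suc k) j \<bullet> ?d j) - eta / 2 * (cmod (residual (Suc k) j))\<^sup>2)
     - decay_rate eps eta * (cmod ((z (Suc (Suc k)) - z (Suc k)) j))\<^sup>2)"
    unfolding energy_def
  proof (intro sum_mono)
    fix j assume "j \<in> {..<m}"
    then have j: "j < m" by simp
    then have fj: "0 \<le> f j" using f by blast
    have diff: "g_grad eps (z (Suc (Suc k)) j) (f j) - g_grad eps (z (Suc k) j) (f j)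
        = eta *\<^sub>R (g (Suc (Suc k)) j - g (Suc k) j)"
      by (simp add: g_grad_z[OF j] scaleR_diff_right)
    let ?Z = "z (Suc (Suc k)) j - z (Suc k) j"
    \<comment> \<open>The tangent is taken at the new point, where the gradient is the new
      multiplier.\<close>
    have "g_eps eps (z (Suc (Suc k)) j) (f j) - g_eps eps (z (Suc k) j) (f j)
        \<le> - (g_grad eps (z (Suc (Suc k)) j) (f j) \<bullet> (z (Suc k) j - z (Suc (Suc k)) j))
          + (1 / eps - 1) / 2 * (cmod (z (Suc k) j - z (Suc (Suc k)) j))\<^sup>2"
      using g_eps_weakly_convex[OF eps fj, of "z (Suc (Suc k)) j" "z (Suc k) j"] by linarith
    also have "\<dots> = eta * (g (Suc (Suc k)) j \<bullet> ?Z) + (1 / eps - 1) / 2 * (cmod ?Z)\<^sup>2"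
      unfolding g_grad_z[OF j] by (simp add: norm_minus_commute inner_diff_right algebra_simps)
    finally have G: "g_eps eps (z (Suc (Suc k)) j) (f j) - g_eps eps (z (Suc k) j) (f j)
        \<le> eta * (g (Suc (Suc k)) j \<bullet> ?Z) + (1 / eps - 1) / 2 * (cmod ?Z)\<^sup>2" .
    have mono: "- (1 / eps - 1) * (cmod ?Z)\<^sup>2 \<le> eta * (?Z \<bullet> (g (Suc (Suc k)) j - g (Suc k) j))"
      using g_grad_hypomonotone[OF eps fj, of "z (Suc (Suc k)) j" "z (Suc k) j"]
      unfolding diff by (simp only: inner_scaleR_right)
    show "g_eps eps (z (Suc (Suc k)) j) (f j)
     + eta * (g (Suc (Suc k)) j \<bullet> (y (Suc (Suc k)) j - z (Suc (Suc k)) j)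
              + (cmod (y (Suc (Suc k)) j - z (Suc (Suc k)) j))\<^sup>2 / 2)
     + eta * (cmod (y (Suc (Suc k)) j - y (Suc k) j))\<^sup>2 + eta * (cmod (g (Suc (Suc k)) j - g (Suc k) j))\<^sup>2
     \<le> (g_eps eps (z (Suc k) j) (f j)
     + eta * (g (Suc k) j \<bullet> (y (Suc k) j - z (Suc k) j) + (cmod (y (Suc k) j - z (Suc k) j))\<^sup>2 / 2)
     + eta * (cmod (y (Suc k) j - y k j))\<^sup>2 + eta * (cmod (g (Suc k) j - g k j))\<^sup>2)
     + eta * (?a j \<bullet> ?d j) + (eta * (residual (Suc k) j \<bullet> ?d j) - eta / 2 * (cmod (residual (Suc k) j))\<^sup>2)
     - decay_rate eps eta * (cmod ((z (Suc (Suc k)) - z (Suc k)) j))\<^sup>2"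
      using block_energy_coordinate[OF eta y_eq[OF j] y_eq[OF j] G mono g_Suc_diff_le[OF j],
          of "y (Suc (Suc k)) j"]
      by (simp add: residual_def decay_rate_def)
  qed
  also have "\<dots> = energy k + eta * reip m ?a ?d + (eta * reip m (residual (Suc k)) ?d
      - eta / 2 * nsq m (residual (Suc k))) - decay_rate eps eta * nsq m (z (Suc (Suc k)) - z (Suc k))"
    by (simp only: sum.distrib sum_subtractf sum_distrib_left[symmetric] energy_def reip_inner nsq_def)
  finally show ?thesis
    using u_optimality[of "Suc k" ?u] u_optimality_diff[of k ?u] dual_step_bound[of k]
    unfolding Au Pu by linarith
qed

end

section \<open>The overlap restriction is a coisometry\<close>

lemma pimat_entry:
  assumes "finite \<Omega>\<^sub>0" "\<Omega>\<^sub>0 \<subseteq> {..<n}" "j < card \<Omega>\<^sub>0"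
  shows "pimat n \<Omega>\<^sub>0 \<Omega>\<^sub>1 j i = (if sorted_list_of_set \<Omega>\<^sub>1 ! i = sorted_list_of_set \<Omega>\<^sub>0 ! j then 1 else 0)"
proof -
  have "sorted_list_of_set \<Omega>\<^sub>0 ! j \<in> set (sorted_list_of_set \<Omega>\<^sub>0)"
    using assms by (intro nth_mem) simp
  then have "sorted_list_of_set \<Omega>\<^sub>0 ! j < n" using assms by auto
  moreover have "pimat n \<Omega>\<^sub>0 \<Omega>\<^sub>1 j i
      = (\<Sum>q<n. if q = sorted_list_of_set \<Omega>\<^sub>0 ! j then (if q = sorted_list_of_set \<Omega>\<^sub>1 ! i then 1 else 0) else 0)"
    unfolding pimat_def mm_def tr_def Rmat_def by (intro sum.cong) auto
  ultimately show ?thesis by auto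
qed

text \<open>The preimage of \<open>x\<close> is its extension by zero from the overlap to the
  subdomain.\<close>

lemma pimat_coisometry:
  assumes sub: "\<Omega>\<^sub>0 \<subseteq> \<Omega>\<^sub>1" and bound: "\<Omega>\<^sub>1 \<subseteq> {..<n}"
  shows "\<exists>h. veq (card \<Omega>\<^sub>0) (mv (pimat n \<Omega>\<^sub>0 \<Omega>\<^sub>1) (card \<Omega>\<^sub>0) (card \<Omega>\<^sub>1) h) x \<and> nsq (card \<Omega>\<^sub>1) h = nsq (card \<Omega>\<^sub>0) x"
proof -
  have fin: "finite \<Omega>\<^sub>1" "finite \<Omega>\<^sub>0"
    using bound sub finite_subset[of _ "{..<n}"] by (auto dest: finite_subset)
  let ?L = "sorted_list_of_set \<Omega>\<^sub>0" and ?M = "sorted_list_of_set \<Omega>\<^sub>1"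
  have "\<exists>i<card \<Omega>\<^sub>1. ?M ! i = ?L ! j" if "j < card \<Omega>\<^sub>0" for j
  proof -
    have "?L ! j \<in> set ?L" using that by (intro nth_mem) simp
    then have "?L ! j \<in> set ?M" using sub fin by auto
    then show ?thesis by (auto simp: in_set_conv_nth)
  qed
  \<comment> \<open>\<open>\<sigma> j\<close> is the position, within the subdomain, of the
    \<open>j\<close>-th overlap pixel.\<close>
  then obtain \<sigma> where \<sigma>: "\<And>j. j < card \<Omega>\<^sub>0 \<Longrightarrow> \<sigma> j < card \<Omega>\<^sub>1 \<and> ?M ! \<sigma> j = ?L ! j"
    by metis
  have inj: "inj_on \<sigma> {..<card \<Omega>\<^sub>0}"
  proof (rule inj_onI)
    fix i j assume ij: "i \<in> {..<card \<Omega>\<^sub>0}" "j \<in> {..<card \<Omega>\<^sub>0}" "\<sigma> i = \<sigma> j"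
    then have "?L ! i = ?L ! j" using \<sigma>[of i] \<sigma>[of j] by simp
    then show "i = j" using ij by (simp add: nth_eq_iff_index_eq)
  qed
  define h where "h i = (if i \<in> \<sigma> ` {..<card \<Omega>\<^sub>0} then x (inv_into {..<card \<Omega>\<^sub>0} \<sigma> i) else 0)" for i
  have h\<sigma>: "h (\<sigma> j) = x j" if "j < card \<Omega>\<^sub>0" for j
    using that inj by (simp add: h_def)
  have "mv (pimat n \<Omega>\<^sub>0 \<Omega>\<^sub>1) (card \<Omega>\<^sub>0) (card \<Omega>\<^sub>1) h j = x j" if j: "j < card \<Omega>\<^sub>0" for j
  proof -
    have "?M ! i = ?L ! j \<longleftrightarrow> i = \<sigma> j" if "i < card \<Omega>\<^sub>1" for i
      using that \<sigma>[OF j] nth_eq_iff_index_eq[of ?M i "\<sigma> j"] by auto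
    then have "(\<Sum>i<card \<Omega>\<^sub>1. pimat n \<Omega>\<^sub>0 \<Omega>\<^sub>1 j i * h i) = (\<Sum>i<card \<Omega>\<^sub>1. if i = \<sigma> j then h i else 0)"
      using fin sub bound j by (intro sum.cong) (auto simp: pimat_entry)
    then show ?thesis using j \<sigma>[OF j] h\<sigma>[OF j] by (simp add: mv_def)
  qed
  moreover have "nsq (card \<Omega>\<^sub>1) h = nsq (card \<Omega>\<^sub>0) x"
  proof -
    have "nsq (card \<Omega>\<^sub>1) h = (\<Sum>i\<in>\<sigma> ` {..<card \<Omega>\<^sub>0}. (cmod (h i))\<^sup>2)"
      unfolding nsq_def using \<sigma> by (intro sum.mono_neutral_right) (auto simp: h_def)
    also have "\<dots> = nsq (card \<Omega>\<^sub>0) x"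
      using inj by (simp add: sum.reindex nsq_def h\<sigma>)
    finally show ?thesis .
  qed
  ultimately show ?thesis unfolding veq_def by blast
qed

section \<open>Convergence of the steps and limit points\<close>

lemma nsq_tendsto_zero_iff: "((\<lambda>k. nsq m (X k)) \<longlongrightarrow> 0) F \<longleftrightarrow> (\<forall>j<m. ((\<lambda>k. X k j) \<longlongrightarrow> 0) F)"
proof safe
  fix j assume lim: "((\<lambda>k. nsq m (X k)) \<longlongrightarrow> 0) F" and j: "j < m"
  have "(cmod (X k j))\<^sup>2 \<le> nsq m (X k)" for k
    unfolding nsq_def using j by (intro member_le_sum) auto
  then have "((\<lambda>k. (cmod (X k j))\<^sup>2) \<longlongrightarrow> 0) F"
    by (intro tendsto_sandwich[OF _ _ tendsto_const lim] always_eventually) auto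
  then show "((\<lambda>k. X k j) \<longlongrightarrow> 0) F"
    using tendsto_real_sqrt[of "\<lambda>k. (cmod (X k j))\<^sup>2" 0 F] by (simp add: tendsto_norm_zero_iff)
next
  assume "\<forall>j<m. ((\<lambda>k. X k j) \<longlongrightarrow> 0) F"
  then have "((\<lambda>k. nsq m (X k)) \<longlongrightarrow> (\<Sum>j<m. (cmod 0)\<^sup>2)) F"
    unfolding nsq_def by (intro tendsto_sum tendsto_power tendsto_norm) auto
  then show "((\<lambda>k. nsq m (X k)) \<longlongrightarrow> 0) F" by simp
qed

lemma tendsto_mv:
  assumes "vconv c X x" shows "(\<lambda>i. mv M r c (X i) j) \<longlonglongrightarrow> mv M r c x j"
  unfolding mv_def using assms by (cases "j < r") (auto simp: vconv_def intro!: tendsto_sum tendsto_mult)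

lemma tendsto_reip:
  assumes "vconv k X x" shows "(\<lambda>i. reip k (X i) b) \<longlonglongrightarrow> reip k x b"
  unfolding reip_inner using assms by (auto simp: vconv_def intro!: tendsto_sum tendsto_inner)

lemma tendsto_nsq:
  assumes "vconv k X x" shows "(\<lambda>i. nsq k (X i)) \<longlonglongrightarrow> nsq k x"
  unfolding nsq_def using assms by (auto simp: vconv_def intro!: tendsto_sum tendsto_power tendsto_norm)

text \<open>A lower bound at infinitely many indices suffices, because a decreasing sequence
  dominates its later values. A convergent subsequence of iterates therefore bounds the whole
  energy.\<close>

lemma descent_tendsto_zero:
  fixes E D :: "nat \<Rightarrow> real"
  assumes descent: "\<And>k. E (Suc k) \<le> E k - D k" and D: "\<And>k. 0 \<le> D k"
    and bound: "\<exists>\<^sub>F k in sequentially. C \<le> E k"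
  shows "D \<longlonglongrightarrow> 0"
proof -
  have dec: "decseq E"
  proof (rule decseq_SucI)
    show "E (Suc k) \<le> E k" for k using descent[of k] D[of k] by linarith
  qed
  have "C \<le> E k" for k
  proof -
    obtain i where "k \<le> i" "C \<le> E i" using bound by (auto simp: frequently_sequentially)
    then show ?thesis using decseqD[OF dec, of k i] by linarith
  qed
  then obtain L where L: "E \<longlonglongrightarrow> L" using decseq_convergent[OF dec] by blast
  have "(\<lambda>k. E k - E (Suc k)) \<longlonglongrightarrow> L - L"
    by (intro tendsto_diff L LIMSEQ_Suc)
  then show ?thesis
    by (intro tendsto_sandwich[OF _ _ tendsto_const, of _ D _ "\<lambda>k. E k - E (Suc k)"] always_eventually)
      (use D descent in \<open>auto simp: algebra_simps\<close>)
qed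

section \<open>Vanishing steps and limit points on one subdomain\<close>

context od2p_block
begin

text \<open>Completing the square in the multiplier term. The bound depends on Gamma and becomes
  uniform along a subsequence on which Gamma converges.\<close>

lemma energy_lower_bound: "- (eta / 2 * nsq m (g (Suc k))) \<le> energy k"
proof -
  have "- (eta / 2 * nsq m (g (Suc k))) = (\<Sum>j<m. - (eta / 2 * (cmod (g (Suc k) j))\<^sup>2))"
    by (simp add: nsq_def sum_negf sum_distrib_left)
  also have "\<dots> \<le> energy k"
    unfolding energy_def
  proof (intro sum_mono)
    fix j assume "j \<in> {..<m}"
    let ?a = "y (Suc k) j - z (Suc k) j"
    have "0 \<le> eta / 2 * (cmod (g (Suc k) j + ?a))\<^sup>2" using eta by simp
    also have "\<dots> = eta / 2 * (cmod (g (Suc k) j))\<^sup>2 + eta * (g (Suc k) j \<bullet> ?a + (cmod ?a)\<^sup>2 / 2)"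
      unfolding power2_norm_eq_inner
      by (simp add: inner_add_left inner_add_right inner_commute algebra_simps add_divide_distrib diff_divide_distrib)
    finally have "- (eta / 2 * (cmod (g (Suc k) j))\<^sup>2) \<le> eta * (g (Suc k) j \<bullet> ?a + (cmod ?a)\<^sup>2 / 2)"
      by simp
    moreover have "0 \<le> g_eps eps (z (Suc k) j) (f j)"
      using f \<open>j \<in> {..<m}\<close> by (intro g_eps_nonneg eps) auto
    moreover have "0 \<le> eta * (cmod (y (Suc k) j - y k j))\<^sup>2" "0 \<le> eta * (cmod (g (Suc k) j - g k j))\<^sup>2"
      using eta by auto
    ultimately show "- (eta / 2 * (cmod (g (Suc k) j))\<^sup>2) \<le> g_eps eps (z (Suc k) j) (f j)
        + eta * (g (Suc k) j \<bullet> ?a + (cmod ?a)\<^sup>2 / 2)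
        + eta * (cmod (y (Suc k) j - y k j))\<^sup>2 + eta * (cmod (g (Suc k) j - g k j))\<^sup>2"
      by linarith
  qed
  finally show ?thesis .
qed

text \<open>The assumption \<open>dz\<close> is supplied later by the descent of the coupled
  energy.\<close>

context
  assumes dz: "(\<lambda>k. nsq m (z (Suc (Suc k)) - z (Suc k))) \<longlonglongrightarrow> 0"
begin

lemma z_diff_tendsto: "j < m \<Longrightarrow> (\<lambda>k. z (Suc k) j - z k j) \<longlonglongrightarrow> 0"
  using dz unfolding nsq_tendsto_zero_iff by - (rule LIMSEQ_imp_Suc, auto)

lemma g_diff_tendsto:
  assumes j: "j < m" shows "(\<lambda>k. g (Suc k) j - g k j) \<longlonglongrightarrow> 0"
\<comment> \<open>The shift is needed because \<open>g_grad_z\<close> speaks only of indices from 1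
  on.\<close>
proof (rule LIMSEQ_imp_Suc, rule tendsto_0_le)
  define K where "K = sqrt (1 + (1 / eps - 1)\<^sup>2) / eta"
  show "(\<lambda>k. z (Suc (Suc k)) j - z (Suc k) j) \<longlonglongrightarrow> 0"
    using z_diff_tendsto[OF j] by (rule LIMSEQ_Suc)
  have "eta * cmod (g (Suc (Suc k)) j - g (Suc k) j)
      \<le> sqrt (1 + (1 / eps - 1)\<^sup>2) * cmod (z (Suc (Suc k)) j - z (Suc k) j)" for k
    using real_sqrt_le_mono[OF g_Suc_diff_le[OF j, of k]] eta by (simp only: real_sqrt_mult) simp
  then show "\<forall>\<^sub>F k in sequentially. cmod (g (Suc (Suc k)) j - g (Suc k) j)
          \<le> cmod (z (Suc (Suc k)) j - z (Suc k) j) * K"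
    using eta by (intro always_eventually allI) (simp add: K_def pos_le_divide_eq mult_ac)
qed

lemma l_diff_tendsto:
  assumes j: "j < nh" shows "(\<lambda>k. l (Suc k) j - l k j) \<longlonglongrightarrow> 0"
proof -
  have "(\<lambda>k. residual (Suc k) j) \<longlonglongrightarrow> 0" if j: "j < m" for j
  proof -
    \<comment> \<open>The multiplier update expresses A u through \<open>z\<close> and Gamma, so the
      residual consists of their steps alone and no control of the steps of \<open>u\<close>
      enters.\<close>
    have "residual (Suc k) j = (z (Suc (Suc (Suc k))) j - z (Suc (Suc k)) j)
        + (g (Suc (Suc (Suc k))) j - g (Suc (Suc k)) j) - (z (Suc (Suc k)) j - z (Suc k) j)" for k
      by (simp add: residual_def y_eq[OF j])
    moreover have "(\<lambda>k. (z (Suc (Suc (Suc k))) j - z (Suc (Suc k)) j)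
        + (g (Suc (Suc (Suc k))) j - g (Suc (Suc k)) j) - (z (Suc (Suc k)) j - z (Suc k) j)) \<longlonglongrightarrow> 0 + 0 - 0"
      by (intro tendsto_diff tendsto_add LIMSEQ_Suc[OF LIMSEQ_Suc[OF z_diff_tendsto[OF j]]]
          LIMSEQ_Suc[OF LIMSEQ_Suc[OF g_diff_tendsto[OF j]]] LIMSEQ_Suc[OF z_diff_tendsto[OF j]])
    ultimately show ?thesis by simp
  qed
  then have "(\<lambda>k. nsq m (residual (Suc k))) \<longlonglongrightarrow> 0"
    by (simp add: nsq_tendsto_zero_iff)
  then have lim: "(\<lambda>k. eta / 2 * nsq m (residual (Suc k)) / r) \<longlonglongrightarrow> 0"
    by (intro tendsto_divide_zero tendsto_mult_right_zero)
  have "nsq nh (l (Suc (Suc k)) - l (Suc k)) \<le> eta / 2 * nsq m (residual (Suc k)) / r" for k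
    using dual_step_bound[of k] r by (simp add: field_simps)
  then have "(\<lambda>k. nsq nh (l (Suc (Suc k)) - l (Suc k))) \<longlonglongrightarrow> 0"
    by (intro tendsto_sandwich[OF _ _ tendsto_const lim] always_eventually) auto
  then show ?thesis
    using j unfolding nsq_tendsto_zero_iff by - (rule LIMSEQ_imp_Suc, auto)
qed

context
  fixes \<phi> :: "nat \<Rightarrow> nat" and us zs gs ls vs :: cvec
  assumes \<phi>: "strict_mono \<phi>"
    and us: "vconv nd (u \<circ> \<phi>) us" and zs: "vconv m (z \<circ> \<phi>) zs" and gs: "vconv m (g \<circ> \<phi>) gs"
    and ls: "vconv nh (l \<circ> \<phi>) ls" and vs: "vconv nh (v \<circ> \<phi>) vs"
begin

private lemma along: "X \<longlonglongrightarrow> x \<Longrightarrow> (\<lambda>i. X (\<phi> i)) \<longlonglongrightarrow> x"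
  using LIMSEQ_subseq_LIMSEQ[OF _ \<phi>] by (simp add: comp_def)

private lemma coordinates:
  "j < m \<Longrightarrow> (\<lambda>i. z (\<phi> i) j) \<longlonglongrightarrow> zs j" "j < m \<Longrightarrow> (\<lambda>i. g (\<phi> i) j) \<longlonglongrightarrow> gs j"
  "j < nh \<Longrightarrow> (\<lambda>i. v (\<phi> i) j) \<longlonglongrightarrow> vs j"
  "(\<lambda>i. y (\<phi> i) j) \<longlonglongrightarrow> mv A m nd us j" "(\<lambda>i. p (\<phi> i) j) \<longlonglongrightarrow> mv P nh nd us j"
  using zs gs vs tendsto_mv[OF us, of A m j] tendsto_mv[OF us, of P nh j]
  by (simp_all add: vconv_def y_def p_def)

lemma limit_consensus:
  assumes j: "j < nh" shows "mv P nh nd us j = vs j"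
proof -
  have "(\<lambda>k. p (Suc k) j - v (Suc k) j) \<longlonglongrightarrow> 0"
    using l_diff_tendsto[OF j] by (simp add: l_Suc[OF j])
  then have "(\<lambda>i. p (\<phi> i) j - v (\<phi> i) j) \<longlonglongrightarrow> 0"
    by (rule along[OF LIMSEQ_imp_Suc])
  moreover have "(\<lambda>i. p (\<phi> i) j - v (\<phi> i) j) \<longlonglongrightarrow> mv P nh nd us j - vs j"
    by (intro tendsto_diff coordinates j)
  ultimately show ?thesis using LIMSEQ_unique by fastforce
qed

lemma limit_measurement:
  assumes j: "j < m" shows "mv A m nd us j = zs j"
proof -
  have "(\<lambda>k. (z (Suc k) j - z k j) + (g (Suc k) j - g k j)) \<longlonglongrightarrow> 0 + 0"
    by (intro tendsto_add z_diff_tendsto g_diff_tendsto j)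
  moreover have "(z (Suc k) j - z k j) + (g (Suc k) j - g k j) = y k j - z k j" for k
    by (simp add: y_eq[OF j])
  ultimately have "(\<lambda>i. y (\<phi> i) j - z (\<phi> i) j) \<longlonglongrightarrow> 0"
    by - (rule along, simp)
  moreover have "(\<lambda>i. y (\<phi> i) j - z (\<phi> i) j) \<longlonglongrightarrow> mv A m nd us j - zs j"
    by (intro tendsto_diff coordinates j)
  ultimately show ?thesis using LIMSEQ_unique by fastforce
qed

lemma limit_gradient:
  assumes j: "j < m" shows "g_grad eps (zs j) (f j) = eta *\<^sub>R gs j"
proof -
  have "(\<lambda>k. g_grad eps (z k j) (f j) - eta *\<^sub>R g k j) \<longlonglongrightarrow> 0"
    by (rule LIMSEQ_imp_Suc) (simp add: g_grad_z[OF j])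
  then have "(\<lambda>i. g_grad eps (z (\<phi> i) j) (f j) - eta *\<^sub>R g (\<phi> i) j) \<longlonglongrightarrow> 0"
    by (rule along)
  moreover have "(\<lambda>i. g_grad eps (z (\<phi> i) j) (f j) - eta *\<^sub>R g (\<phi> i) j)
      \<longlonglongrightarrow> g_grad eps (zs j) (f j) - eta *\<^sub>R gs j"
    using f j by (intro tendsto_diff tendsto_g_grad eps tendsto_scaleR tendsto_const coordinates) auto
  ultimately show ?thesis using LIMSEQ_unique by fastforce
qed

text \<open>In the limit A u and z cancel by \<open>limit_measurement\<close>, so A u + Gamma - z
  tends to Gamma, which gives stationarity in u.\<close>

lemma limit_u_optimality:
  "eta * reip m gs (mv A m nd h) + r * reip nh ls (mv P nh nd h) = 0"
proof -
  have "(\<lambda>k. eta * reip m (y k + g k - z k) (mv A m nd h) + r * reip nh (l k) (mv P nh nd h)) \<longlonglongrightarrow> 0"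
    by (rule LIMSEQ_imp_Suc) (simp add: u_optimality)
  then have "(\<lambda>i. eta * reip m (y (\<phi> i) + g (\<phi> i) - z (\<phi> i)) (mv A m nd h)
      + r * reip nh (l (\<phi> i)) (mv P nh nd h)) \<longlonglongrightarrow> 0"
    by (rule along)
  moreover have "vconv m (\<lambda>i. y (\<phi> i) + g (\<phi> i) - z (\<phi> i)) gs"
    unfolding vconv_def
  proof (intro allI impI)
    fix j assume j: "j < m"
    have "(\<lambda>i. y (\<phi> i) j + g (\<phi> i) j - z (\<phi> i) j) \<longlonglongrightarrow> mv A m nd us j + gs j - zs j"
      by (intro tendsto_diff tendsto_add coordinates j)
    then show "(\<lambda>i. (y (\<phi> i) + g (\<phi> i) - z (\<phi> i)) j) \<longlonglongrightarrow> gs j"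
      by (simp add: limit_measurement[OF j])
  qed
  then have "(\<lambda>i. eta * reip m (y (\<phi> i) + g (\<phi> i) - z (\<phi> i)) (mv A m nd h)
      + r * reip nh (l (\<phi> i)) (mv P nh nd h)) \<longlonglongrightarrow> eta * reip m gs (mv A m nd h) + r * reip nh ls (mv P nh nd h)"
    using ls by (intro tendsto_add tendsto_mult tendsto_const tendsto_reip) (simp_all add: comp_def)
  ultimately show ?thesis using LIMSEQ_unique by blast
qed

end

end

end

section \<open>Stationary points of the augmented Lagrangian\<close>

definition penalty :: "nat \<Rightarrow> cvec \<Rightarrow> cvec \<Rightarrow> real" where
  "penalty k l a = reip k l a + nsq k a / 2"

lemma penalty_eq_0: "(\<And>j. j < k \<Longrightarrow> a j = 0) \<Longrightarrow> penalty k l a = 0"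
  by (simp add: penalty_def reip_inner nsq_def)

lemma penalty_line:
  assumes "\<And>j. j < k \<Longrightarrow> a j = complex_of_real t * d j"
  shows "penalty k l a = t * reip k l d + t\<^sup>2 * (nsq k d / 2)"
proof -
  have "l j \<bullet> a j = t * (l j \<bullet> d j)" "(cmod (a j))\<^sup>2 = t\<^sup>2 * (cmod (d j))\<^sup>2" if "j < k" for j
    using assms[OF that] by (simp_all add: norm_mult power_mult_distrib inner_complex_def algebra_simps)
  then show ?thesis
    by (simp add: penalty_def reip_inner nsq_def sum_distrib_left)
qed

lemma Lag_penalty:
  "Lag eps r eta n1 n2 nh m1 m2 f1 f2 A1 A2 P12 P21 u1 u2 v z1 z2 l12 l21 g1 g2 =
     G_eps eps m1 z1 f1 + G_eps eps m2 z2 f2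
     + r * (penalty nh l12 (mv P12 nh n1 u1 - v) + penalty nh l21 (mv P21 nh n2 u2 - v))
     + eta * (penalty m1 g1 (mv A1 m1 n1 u1 - z1) + penalty m2 g2 (mv A2 m2 n2 u2 - z2))"
  by (simp add: Lag_def penalty_def)

text \<open>Quadratic deviation forces the difference quotients to 0. The piecewise metric is
  thereby handled through its two-sided quadratic bounds.\<close>

lemma grad_zeroI:
  assumes "\<And>d. \<exists>C. \<forall>t. \<bar>F (\<lambda>i. x i + complex_of_real t * d i) - F x\<bar> \<le> C * t\<^sup>2"
  shows "grad_zero F k x"
  unfolding grad_zero_def
proof (intro allI impI ballI)
  fix j and e :: complex
  define d :: cvec where "d = (\<lambda>i. if i = j then e else 0)"
  obtain C where C: "\<And>t. \<bar>F (\<lambda>i. x i + complex_of_real t * d i) - F x\<bar> \<le> C * t\<^sup>2"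
    using assms by blast
  have x: "x(j := x j + complex_of_real t * e) = (\<lambda>i. x i + complex_of_real t * d i)" for t
    by (auto simp: d_def)
  have "((\<lambda>t. (F (\<lambda>i. x i + complex_of_real t * d i) - F x) / t) \<longlongrightarrow> 0) (at 0)"
  proof (rule tendsto_0_le[where K = C])
    show "((\<lambda>t::real. t) \<longlongrightarrow> 0) (at 0)" by (rule tendsto_ident_at)
    show "\<forall>\<^sub>F t in at 0. norm ((F (\<lambda>i. x i + complex_of_real t * d i) - F x) / t) \<le> norm t * C"
      unfolding eventually_at_filter
      using C by (intro always_eventually) (simp add: power2_eq_square pos_divide_le_eq mult_ac flip: abs_mult)
  qed
  then show "((\<lambda>t. F (x(j := x j + complex_of_real t * e))) has_real_derivative 0) (at 0)"
    unfolding x by (simp add: DERIV_def)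
qed

lemma G_eps_line:
  assumes eps: "0 < eps" "eps < 1" and f: "\<forall>j<m. 0 \<le> f j"
  shows "\<bar>G_eps eps m (\<lambda>j. z j + complex_of_real t * d j) f - G_eps eps m z f
           - t * reip m (\<lambda>j. g_grad eps (z j) (f j)) d\<bar> \<le> (1 + 1 / eps) / 2 * nsq m d * t\<^sup>2"
proof -
  have "\<bar>g_eps eps (z j + complex_of_real t * d j) (f j) - g_eps eps (z j) (f j)
      - t * (g_grad eps (z j) (f j) \<bullet> d j)\<bar> \<le> (1 + 1 / eps) / 2 * (cmod (d j))\<^sup>2 * t\<^sup>2" if "j < m" for j
  proof -
    have fj: "0 \<le> f j" using f that by blast
    let ?x = "z j + complex_of_real t * d j"
    have x: "?x - z j = t *\<^sub>R d j" by (simp add: scaleR_conv_of_real)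
    \<comment> \<open>These terms enlarge the curvature bounds 1 and \<open>1 / eps - 1\<close> to
      the common \<open>1 + 1 / eps\<close>.\<close>
    have n: "0 \<le> t\<^sup>2 * (cmod (d j))\<^sup>2" "0 \<le> t\<^sup>2 * (cmod (d j))\<^sup>2 / (eps * 2)" using eps by auto
    show ?thesis
      using g_eps_weakly_convex[OF eps fj, of "z j" ?x] g_eps_smooth[OF eps fj, of ?x "z j"]
      unfolding x
      by (simp add: power_mult_distrib abs_le_iff algebra_simps add_divide_distrib diff_divide_distrib)
        (use n in linarith)
  qed
  then have "(\<Sum>j<m. \<bar>g_eps eps (z j + complex_of_real t * d j) (f j) - g_eps eps (z j) (f j)
      - t * (g_grad eps (z j) (f j) \<bullet> d j)\<bar>) \<le> (\<Sum>j<m. (1 + 1 / eps) / 2 * (cmod (d j))\<^sup>2 * t\<^sup>2)"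
    by (intro sum_mono) auto
  then have "\<bar>\<Sum>j<m. g_eps eps (z j + complex_of_real t * d j) (f j) - g_eps eps (z j) (f j)
      - t * (g_grad eps (z j) (f j) \<bullet> d j)\<bar> \<le> (\<Sum>j<m. (1 + 1 / eps) / 2 * (cmod (d j))\<^sup>2 * t\<^sup>2)"
    by (rule order_trans[OF sum_abs])
  then show ?thesis
    by (simp add: G_eps_def reip_inner nsq_def sum_subtractf sum_distrib_left sum_distrib_right)
qed

lemma G_eps_line_le:
  assumes eps: "0 < eps" "eps < 1" and f: "\<forall>j<m. 0 \<le> f j"
    and g: "\<And>j. j < m \<Longrightarrow> g_grad eps (z j) (f j) = eta *\<^sub>R g j"
  shows "\<bar>G_eps eps m (\<lambda>j. z j + complex_of_real t * d j) f - G_eps eps m z f - eta * (t * reip m g d)\<bar>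
           \<le> (1 + 1 / eps) / 2 * nsq m d * t\<^sup>2"
proof -
  have "reip m (\<lambda>j. g_grad eps (z j) (f j)) d = eta * reip m g d"
    by (simp add: reip_inner g sum_distrib_left)
  then show ?thesis using G_eps_line[OF eps f, of z t d] by (simp add: mult.left_commute)
qed

text \<open>At a feasible point every penalty vanishes, so along a line each becomes a linear plus a
  quadratic term. The remaining hypotheses cancel the linear terms in \<open>u\<close>,
  \<open>v\<close> and \<open>z\<close>.\<close>

lemma stationary_LagI:
  assumes eps: "0 < eps" "eps < 1" and f: "\<forall>j<m1. 0 \<le> f1 j" "\<forall>j<m2. 0 \<le> f2 j"
    and c: "\<And>j. j < nh \<Longrightarrow> mv P12 nh n1 u1 j = v j" "\<And>j. j < nh \<Longrightarrow> mv P21 nh n2 u2 j = v j"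
      "\<And>j. j < m1 \<Longrightarrow> mv A1 m1 n1 u1 j = z1 j" "\<And>j. j < m2 \<Longrightarrow> mv A2 m2 n2 u2 j = z2 j"
    and l: "\<And>j. j < nh \<Longrightarrow> l12 j + l21 j = 0"
    and g1: "\<And>j. j < m1 \<Longrightarrow> g_grad eps (z1 j) (f1 j) = eta *\<^sub>R g1 j"
    and g2: "\<And>j. j < m2 \<Longrightarrow> g_grad eps (z2 j) (f2 j) = eta *\<^sub>R g2 j"
    and o1: "\<And>h. eta * reip m1 g1 (mv A1 m1 n1 h) + r * reip nh l12 (mv P12 nh n1 h) = 0"
    and o2: "\<And>h. eta * reip m2 g2 (mv A2 m2 n2 h) + r * reip nh l21 (mv P21 nh n2 h) = 0"
  shows "stationary (Lag eps r eta n1 n2 nh m1 m2 f1 f2 A1 A2 P12 P21) n1 n2 nh m1 m2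
           u1 u2 v z1 z2 l12 l21 g1 g2"
proof -
  have zero: "penalty nh x (mv P12 nh n1 u1 - v) = 0" "penalty nh x (mv P21 nh n2 u2 - v) = 0"
    "penalty m1 x (mv A1 m1 n1 u1 - z1) = 0" "penalty m2 x (mv A2 m2 n2 u2 - z2) = 0" for x
    by (auto intro!: penalty_eq_0 simp: c)
  have u: "penalty nh l12 (mv P12 nh n1 (\<lambda>i. u1 i + complex_of_real t * d i) - v)
        = t * reip nh l12 (mv P12 nh n1 d) + t\<^sup>2 * (nsq nh (mv P12 nh n1 d) / 2)"
      "penalty nh l21 (mv P21 nh n2 (\<lambda>i. u2 i + complex_of_real t * d i) - v)
        = t * reip nh l21 (mv P21 nh n2 d) + t\<^sup>2 * (nsq nh (mv P21 nh n2 d) / 2)"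
      "penalty m1 g1 (mv A1 m1 n1 (\<lambda>i. u1 i + complex_of_real t * d i) - z1)
        = t * reip m1 g1 (mv A1 m1 n1 d) + t\<^sup>2 * (nsq m1 (mv A1 m1 n1 d) / 2)"
      "penalty m2 g2 (mv A2 m2 n2 (\<lambda>i. u2 i + complex_of_real t * d i) - z2)
        = t * reip m2 g2 (mv A2 m2 n2 d) + t\<^sup>2 * (nsq m2 (mv A2 m2 n2 d) / 2)" for t d
    by (rule penalty_line, simp add: mv_add_mult c)+
  have neg: "penalty nh l12 (mv P12 nh n1 u1 - (\<lambda>i. v i + complex_of_real t * d i))
        = - t * reip nh l12 d + (- t)\<^sup>2 * (nsq nh d / 2)"
      "penalty nh l21 (mv P21 nh n2 u2 - (\<lambda>i. v i + complex_of_real t * d i))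
        = - t * reip nh l21 d + (- t)\<^sup>2 * (nsq nh d / 2)"
      "penalty m1 g1 (mv A1 m1 n1 u1 - (\<lambda>i. z1 i + complex_of_real t * d i))
        = - t * reip m1 g1 d + (- t)\<^sup>2 * (nsq m1 d / 2)"
      "penalty m2 g2 (mv A2 m2 n2 u2 - (\<lambda>i. z2 i + complex_of_real t * d i))
        = - t * reip m2 g2 d + (- t)\<^sup>2 * (nsq m2 d / 2)" for t d
    by (rule penalty_line, simp add: c)+
  have l': "reip nh l12 d + reip nh l21 d = 0" for d
    unfolding reip_inner by (simp add: l flip: sum.distrib inner_add_left)
  let ?L = "Lag eps r eta n1 n2 nh m1 m2 f1 f2 A1 A2 P12 P21"
  have "grad_zero (\<lambda>x. ?L x u2 v z1 z2 l12 l21 g1 g2) n1 u1"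
  proof (intro grad_zeroI exI allI)
    fix d t
    have "t * (eta * reip m1 g1 (mv A1 m1 n1 d) + r * reip nh l12 (mv P12 nh n1 d)) = 0"
      using o1[of d] by simp
    then show "\<bar>?L (\<lambda>i. u1 i + complex_of_real t * d i) u2 v z1 z2 l12 l21 g1 g2 - ?L u1 u2 v z1 z2 l12 l21 g1 g2\<bar>
        \<le> \<bar>r * (nsq nh (mv P12 nh n1 d) / 2) + eta * (nsq m1 (mv A1 m1 n1 d) / 2)\<bar> * t\<^sup>2"
      unfolding Lag_penalty zero u
      by (subst abs_power2[symmetric], subst abs_mult[symmetric], intro eq_refl arg_cong[where f = abs])
        (simp add: algebra_simps)
  qed
  moreover have "grad_zero (\<lambda>x. ?L u1 x v z1 z2 l12 l21 g1 g2) n2 u2"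
  proof (intro grad_zeroI exI allI)
    fix d t
    have "t * (eta * reip m2 g2 (mv A2 m2 n2 d) + r * reip nh l21 (mv P21 nh n2 d)) = 0"
      using o2[of d] by simp
    then show "\<bar>?L u1 (\<lambda>i. u2 i + complex_of_real t * d i) v z1 z2 l12 l21 g1 g2 - ?L u1 u2 v z1 z2 l12 l21 g1 g2\<bar>
        \<le> \<bar>r * (nsq nh (mv P21 nh n2 d) / 2) + eta * (nsq m2 (mv A2 m2 n2 d) / 2)\<bar> * t\<^sup>2"
      unfolding Lag_penalty zero u
      by (subst abs_power2[symmetric], subst abs_mult[symmetric], intro eq_refl arg_cong[where f = abs])
        (simp add: algebra_simps)
  qed
  moreover have "grad_zero (\<lambda>x. ?L u1 u2 x z1 z2 l12 l21 g1 g2) nh v"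
  proof (intro grad_zeroI exI allI)
    fix d t
    have "r * t * (reip nh l12 d + reip nh l21 d) = 0"
      using l'[of d] by simp
    then show "\<bar>?L u1 u2 (\<lambda>i. v i + complex_of_real t * d i) z1 z2 l12 l21 g1 g2 - ?L u1 u2 v z1 z2 l12 l21 g1 g2\<bar>
        \<le> \<bar>r * nsq nh d\<bar> * t\<^sup>2"
      unfolding Lag_penalty zero neg
      by (subst abs_power2[symmetric], subst abs_mult[symmetric], intro eq_refl arg_cong[where f = abs])
        (simp add: algebra_simps)
  qed
  moreover have "grad_zero (\<lambda>x. ?L u1 u2 v x z2 l12 l21 g1 g2) m1 z1"
  proof (intro grad_zeroI exI allI)
    fix d t
    show "\<bar>?L u1 u2 v (\<lambda>i. z1 i + complex_of_real t * d i) z2 l12 l21 g1 g2 - ?L u1 u2 v z1 z2 l12 l21 g1 g2\<bar>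
        \<le> ((1 + 1 / eps) / 2 * nsq m1 d + \<bar>eta * (nsq m1 d / 2)\<bar>) * t\<^sup>2"
    (is "\<bar>?D\<bar> \<le> _")
    proof -
      have "?D = (G_eps eps m1 (\<lambda>i. z1 i + complex_of_real t * d i) f1 - G_eps eps m1 z1 f1
          - eta * (t * reip m1 g1 d)) + eta * (nsq m1 d / 2) * t\<^sup>2"
        unfolding Lag_penalty zero neg by (simp add: algebra_simps)
      moreover have "\<bar>eta * (nsq m1 d / 2) * t\<^sup>2\<bar> = \<bar>eta * (nsq m1 d / 2)\<bar> * t\<^sup>2"
        unfolding abs_mult[of _ "t\<^sup>2"] by simp
      ultimately show ?thesis
        using G_eps_line_le[OF eps f(1) g1, of t d] unfolding distrib_right by linarith
    qed
  qed
  moreover have "grad_zero (\<lambda>x. ?L u1 u2 v z1 x l12 l21 g1 g2) m2 z2"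
  proof (intro grad_zeroI exI allI)
    fix d t
    show "\<bar>?L u1 u2 v z1 (\<lambda>i. z2 i + complex_of_real t * d i) l12 l21 g1 g2 - ?L u1 u2 v z1 z2 l12 l21 g1 g2\<bar>
        \<le> ((1 + 1 / eps) / 2 * nsq m2 d + \<bar>eta * (nsq m2 d / 2)\<bar>) * t\<^sup>2"
    (is "\<bar>?D\<bar> \<le> _")
    proof -
      have "?D = (G_eps eps m2 (\<lambda>i. z2 i + complex_of_real t * d i) f2 - G_eps eps m2 z2 f2
          - eta * (t * reip m2 g2 d)) + eta * (nsq m2 d / 2) * t\<^sup>2"
        unfolding Lag_penalty zero neg by (simp add: algebra_simps)
      moreover have "\<bar>eta * (nsq m2 d / 2) * t\<^sup>2\<bar> = \<bar>eta * (nsq m2 d / 2)\<bar> * t\<^sup>2"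
        unfolding abs_mult[of _ "t\<^sup>2"] by simp
      ultimately show ?thesis
        using G_eps_line_le[OF eps f(2) g2, of t d] unfolding distrib_right by linarith
    qed
  qed
  \<comment> \<open>With vanishing constraint residuals the Lagrangian is constant in each
    multiplier, so the constant 0 serves.\<close>
  moreover have "grad_zero (\<lambda>x. ?L u1 u2 v z1 z2 x l21 g1 g2) nh l12"
    "grad_zero (\<lambda>x. ?L u1 u2 v z1 z2 l12 x g1 g2) nh l21"
    "grad_zero (\<lambda>x. ?L u1 u2 v z1 z2 l12 l21 x g2) m1 g1"
    "grad_zero (\<lambda>x. ?L u1 u2 v z1 z2 l12 l21 g1 x) m2 g2"
    by (rule grad_zeroI, simp only: Lag_penalty zero, rule exI[of _ 0], simp)+
  ultimately show ?thesis unfolding stationary_def by blast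
qed

section \<open>The coupled iteration\<close>

locale od2p =
  b1: od2p_block eps eta r n1 nh m1 A1 P1 f1 u1 z1 g1 l1 v +
  b2: od2p_block eps eta r n2 nh m2 A2 P2 f2 u2 z2 g2 l2 v
  for eps eta r n1 n2 nh m1 m2 A1 A2 P1 P2 f1 f2 u1 u2 v z1 z2 l1 l2 g1 g2 +
  assumes v_step: "\<forall>k. veq nh (v (Suc k))
      (\<lambda>j. ((mv P1 nh n1 (u1 k) j + l1 k j) + (mv P2 nh n2 (u2 k) j + l2 k j)) / 2)"
    and decay_pos: "0 < decay_rate eps eta"
begin

text \<open>Overlap part of the energy before the factor \<open>r\<close>, with the ADMM contraction
  terms included; index \<open>k\<close> again refers to iterate \<open>k + 1\<close>.\<close>

definition consensus :: "nat \<Rightarrow> real" where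
  "consensus k = (\<Sum>j<nh.
     (l1 (Suc k) j \<bullet> (b1.p (Suc k) j - v (Suc k) j) + (cmod (b1.p (Suc k) j - v (Suc k) j))\<^sup>2 / 2)
     + (l2 (Suc k) j \<bullet> (b2.p (Suc k) j - v (Suc k) j) + (cmod (b2.p (Suc k) j - v (Suc k) j))\<^sup>2 / 2)
     + ((cmod (b1.p (Suc k) j - b1.p k j))\<^sup>2 + (cmod (l1 (Suc k) j - l1 k j))\<^sup>2
        + (cmod (b2.p (Suc k) j - b2.p k j))\<^sup>2 + (cmod (l2 (Suc k) j - l2 k j))\<^sup>2) / 2)"

lemma v_Suc: "j < nh \<Longrightarrow> 2 * v (Suc k) j = (b1.p k j + l1 k j) + (b2.p k j + l2 k j)"
  using v_step[rule_format, of k] by (simp add: veq_def b1.p_def b2.p_def mult.commute)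

lemma consensus_descent:
  "consensus (Suc k) \<le> consensus k
     + (reip nh (l1 (Suc (Suc k))) (b1.p (Suc (Suc k)) - b1.p (Suc k))
        + reip nh (l1 (Suc (Suc k)) - l1 (Suc k)) (b1.p (Suc (Suc k)) - b1.p (Suc k))
        + nsq nh (l1 (Suc (Suc k)) - l1 (Suc k)) - nsq nh (b1.p (Suc (Suc k)) - b1.p (Suc k)) / 2)
     + (reip nh (l2 (Suc (Suc k))) (b2.p (Suc (Suc k)) - b2.p (Suc k))
        + reip nh (l2 (Suc (Suc k)) - l2 (Suc k)) (b2.p (Suc (Suc k)) - b2.p (Suc k))
        + nsq nh (l2 (Suc (Suc k)) - l2 (Suc k)) - nsq nh (b2.p (Suc (Suc k)) - b2.p (Suc k)) / 2)"
  unfolding consensus_def reip_inner nsq_def sum_divide_distrib sum.distrib[symmetric] sum_subtractf[symmetric]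
    minus_apply
  by (intro sum_mono consensus_energy_coordinate v_Suc b1.l_Suc b2.l_Suc) auto

definition total :: "nat \<Rightarrow> real" where
  "total k = b1.energy k + b2.energy k + r * consensus k"

definition total_decay :: "nat \<Rightarrow> real" where
  "total_decay k = decay_rate eps eta * (nsq m1 (z1 (Suc (Suc k)) - z1 (Suc k)) + nsq m2 (z2 (Suc (Suc k)) - z2 (Suc k)))
     + r / 2 * (nsq nh (b1.p (Suc (Suc k)) - b1.p (Suc k)) + nsq nh (b2.p (Suc (Suc k)) - b2.p (Suc k)))"

text \<open>All overlap inner products and the squared Lambda steps cancel between the subdomain and
  consensus estimates, leaving the steps of \<open>z\<close> and pi u.\<close>

lemma total_descent: "total (Suc k) \<le> total k - total_decay k"
  using b1.energy_descent[of k] b2.energy_descent[of k]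
    mult_left_mono[OF consensus_descent[of k], of r] b1.r
  unfolding total_def total_decay_def
  by (simp add: distrib_left right_diff_distrib)

lemma consensus_lower_bound: "- (nsq nh (l1 (Suc k)) + nsq nh (l2 (Suc k))) / 2 \<le> consensus k"
proof -
  have *: "- (cmod a)\<^sup>2 / 2 \<le> a \<bullet> b + (cmod b)\<^sup>2 / 2" for a b :: complex
  proof -
    have "0 \<le> (cmod (a + b))\<^sup>2 / 2" by simp
    then show ?thesis
      unfolding power2_norm_eq_inner
      by (simp add: inner_add_left inner_add_right inner_commute add_divide_distrib)
  qed
  have "- (nsq nh (l1 (Suc k)) + nsq nh (l2 (Suc k))) / 2
      = (\<Sum>j<nh. - (cmod (l1 (Suc k) j))\<^sup>2 / 2 + - (cmod (l2 (Suc k) j))\<^sup>2 / 2)"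
    by (simp add: nsq_def sum.distrib sum_negf sum_divide_distrib sum_subtractf add_divide_distrib diff_divide_distrib)
  also have "\<dots> \<le> consensus k"
    unfolding consensus_def
  proof (intro sum_mono)
    fix j
    have "0 \<le> ((cmod (b1.p (Suc k) j - b1.p k j))\<^sup>2 + (cmod (l1 (Suc k) j - l1 k j))\<^sup>2
        + (cmod (b2.p (Suc k) j - b2.p k j))\<^sup>2 + (cmod (l2 (Suc k) j - l2 k j))\<^sup>2) / 2"
      by simp
    then show "- (cmod (l1 (Suc k) j))\<^sup>2 / 2 + - (cmod (l2 (Suc k) j))\<^sup>2 / 2 \<le>
     (l1 (Suc k) j \<bullet> (b1.p (Suc k) j - v (Suc k) j) + (cmod (b1.p (Suc k) j - v (Suc k) j))\<^sup>2 / 2)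
     + (l2 (Suc k) j \<bullet> (b2.p (Suc k) j - v (Suc k) j) + (cmod (b2.p (Suc k) j - v (Suc k) j))\<^sup>2 / 2)
     + ((cmod (b1.p (Suc k) j - b1.p k j))\<^sup>2 + (cmod (l1 (Suc k) j - l1 k j))\<^sup>2
        + (cmod (b2.p (Suc k) j - b2.p k j))\<^sup>2 + (cmod (l2 (Suc k) j - l2 k j))\<^sup>2) / 2"
      using *[of "l1 (Suc k) j" "b1.p (Suc k) j - v (Suc k) j"]
        *[of "l2 (Suc k) j" "b2.p (Suc k) j - v (Suc k) j"] by linarith
  qed
  finally show ?thesis .
qed

lemma frequently_total_bounded_below:
  assumes \<phi>: "strict_mono \<phi>"
    and g: "vconv m1 (g1 \<circ> \<phi>) gs1" "vconv m2 (g2 \<circ> \<phi>) gs2"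
    and l: "vconv nh (l1 \<circ> \<phi>) ls1" "vconv nh (l2 \<circ> \<phi>) ls2"
  shows "\<exists>C. \<exists>\<^sub>F k in sequentially. C \<le> total k"
proof -
  define B where "B k = eta / 2 * nsq m1 (g1 k) + eta / 2 * nsq m2 (g2 k)
    + r * ((nsq nh (l1 k) + nsq nh (l2 k)) / 2)" for k
  have low: "- B (Suc k) \<le> total k" for k
  proof -
    have "r * (- (nsq nh (l1 (Suc k)) + nsq nh (l2 (Suc k))) / 2) \<le> r * consensus k"
      using consensus_lower_bound[of k] b1.r by (intro mult_left_mono) auto
    then show ?thesis
      using b1.energy_lower_bound[of k] b2.energy_lower_bound[of k]
      unfolding B_def total_def by (simp only: minus_divide_left[symmetric] mult_minus_right)
  qed
  have "(\<lambda>i. B (\<phi> i)) \<longlonglongrightarrow> eta / 2 * nsq m1 gs1 + eta / 2 * nsq m2 gs2 + r * ((nsq nh ls1 + nsq nh ls2) / 2)"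
    unfolding B_def
    using tendsto_nsq[OF g(1)] tendsto_nsq[OF g(2)] tendsto_nsq[OF l(1)] tendsto_nsq[OF l(2)]
    by (intro tendsto_add tendsto_mult tendsto_divide tendsto_const) (simp_all add: comp_def)
  then have "convergent (\<lambda>i. B (\<phi> i))" by (rule convergentI)
  then obtain K where K: "\<And>i. norm (B (\<phi> i)) \<le> K"
    using convergent_imp_Bseq BseqE by metis
  have "\<exists>k\<ge>N. - K \<le> total k" for N
  proof -
    \<comment> \<open>\<open>total k\<close> is bounded through iterate \<open>k + 1\<close>, so a
      positive value of \<open>\<phi>\<close> is needed; starting from \<open>Suc N\<close> keeps
      its predecessor above \<open>N\<close>.\<close>
    obtain k where k: "\<phi> (Suc N) = Suc k"
      using seq_suble[OF \<phi>, of "Suc N"] by (cases "\<phi> (Suc N)") auto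
    then have "N \<le> k" using seq_suble[OF \<phi>, of "Suc N"] by simp
    moreover have "- K \<le> total k" using low[of k] K[of "Suc N"] unfolding k by simp
    ultimately show ?thesis by blast
  qed
  then show ?thesis by (auto simp: frequently_sequentially)
qed

lemma limit_point_stationary:
  assumes "limit_point n1 n2 nh m1 m2 u1 u2 v z1 z2 l1 l2 g1 g2 us1 us2 vs zs1 zs2 ls1 ls2 gs1 gs2"
  shows "stationary (Lag eps r eta n1 n2 nh m1 m2 f1 f2 A1 A2 P1 P2) n1 n2 nh m1 m2
           us1 us2 vs zs1 zs2 ls1 ls2 gs1 gs2"
proof -
  obtain \<phi> where \<phi>: "strict_mono \<phi>"
    and u: "vconv n1 (u1 \<circ> \<phi>) us1" "vconv n2 (u2 \<circ> \<phi>) us2" and v: "vconv nh (v \<circ> \<phi>) vs"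
    and z: "vconv m1 (z1 \<circ> \<phi>) zs1" "vconv m2 (z2 \<circ> \<phi>) zs2"
    and l: "vconv nh (l1 \<circ> \<phi>) ls1" "vconv nh (l2 \<circ> \<phi>) ls2"
    and g: "vconv m1 (g1 \<circ> \<phi>) gs1" "vconv m2 (g2 \<circ> \<phi>) gs2"
    using assms unfolding limit_point_def by blast
  obtain C where C: "\<exists>\<^sub>F k in sequentially. C \<le> total k"
    using frequently_total_bounded_below[OF \<phi> g l] by blast
  have parts: "0 \<le> decay_rate eps eta * nsq m1 x" "0 \<le> decay_rate eps eta * nsq m2 x" "0 \<le> r / 2 * nsq nh x" for x
    using decay_pos b1.r by auto
  have decay0: "total_decay \<longlonglongrightarrow> 0"
  proof (rule descent_tendsto_zero[OF total_descent _ C])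
    show "0 \<le> total_decay k" for k
      using decay_pos b1.r by (simp add: total_decay_def)
  qed
  \<comment> \<open>Each nonnegative summand of the decay is squeezed to 0 by the whole.\<close>
  have part: "X \<longlonglongrightarrow> 0" if c: "0 < c" and X: "\<And>k. 0 \<le> X k" "\<And>k. c * X k \<le> total_decay k" for c and X :: "nat \<Rightarrow> real"
  proof (rule tendsto_sandwich[OF _ _ tendsto_const])
    show "(\<lambda>k. total_decay k / c) \<longlonglongrightarrow> 0" using decay0 by (rule tendsto_divide_zero)
    show "\<forall>\<^sub>F k in sequentially. X k \<le> total_decay k / c"
      using c X by (auto simp: field_simps)
  qed (use X in auto)
  have dz1: "(\<lambda>k. nsq m1 (z1 (Suc (Suc k)) - z1 (Suc k))) \<longlonglongrightarrow> 0"
    and dz2: "(\<lambda>k. nsq m2 (z2 (Suc (Suc k)) - z2 (Suc k))) \<longlonglongrightarrow> 0"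
    by (rule part[OF decay_pos], simp, unfold total_decay_def distrib_left, use parts in \<open>simp add: add_increasing\<close>)+
  have "0 < r / 2" using b1.r by simp
  then have dp: "(\<lambda>k. nsq nh (b1.p (Suc (Suc k)) - b1.p (Suc k))) \<longlonglongrightarrow> 0"
      "(\<lambda>k. nsq nh (b2.p (Suc (Suc k)) - b2.p (Suc k))) \<longlonglongrightarrow> 0"
    by (rule part, simp, unfold total_decay_def distrib_left, use parts in \<open>simp add: add_increasing\<close>)+
  have ls: "ls1 j + ls2 j = 0" if j: "j < nh" for j
  proof -
    \<comment> \<open>Since \<open>v\<close> is the average, the multipliers sum to the steps of pi
      u, which vanish; this gives stationarity in \<open>v\<close>.\<close>
    have "l1 (Suc k) j + l2 (Suc k) j = (b1.p (Suc k) - b1.p k) j + (b2.p (Suc k) - b2.p k) j" for k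
      using v_Suc[OF j, of k] by (simp add: b1.l_Suc[OF j] b2.l_Suc[OF j] algebra_simps)
    moreover have "(\<lambda>k. (b1.p (Suc (Suc k)) - b1.p (Suc k)) j + (b2.p (Suc (Suc k)) - b2.p (Suc k)) j) \<longlonglongrightarrow> 0 + 0"
      using dp j unfolding nsq_tendsto_zero_iff by (intro tendsto_add) auto
    ultimately have "(\<lambda>k. l1 (Suc (Suc k)) j + l2 (Suc (Suc k)) j) \<longlonglongrightarrow> 0"
      by simp
    then have "(\<lambda>k. l1 k j + l2 k j) \<longlonglongrightarrow> 0"
      by - (rule LIMSEQ_imp_Suc, rule LIMSEQ_imp_Suc)
    then have "(\<lambda>i. l1 (\<phi> i) j + l2 (\<phi> i) j) \<longlonglongrightarrow> 0"
      using LIMSEQ_subseq_LIMSEQ[OF _ \<phi>] by (fastforce simp: comp_def)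
    moreover have "(\<lambda>i. l1 (\<phi> i) j + l2 (\<phi> i) j) \<longlonglongrightarrow> ls1 j + ls2 j"
      using l j by (intro tendsto_add) (auto simp: vconv_def)
    ultimately show ?thesis using LIMSEQ_unique by blast
  qed
  show ?thesis
    by (rule stationary_LagI[OF b1.eps b1.f b2.f b1.limit_consensus[OF dz1 \<phi> u(1) z(1) g(1) l(1) v]
          b2.limit_consensus[OF dz2 \<phi> u(2) z(2) g(2) l(2) v]
          b1.limit_measurement[OF dz1 \<phi> u(1) z(1) g(1) l(1) v]
          b2.limit_measurement[OF dz2 \<phi> u(2) z(2) g(2) l(2) v] ls
          b1.limit_gradient[OF dz1 \<phi> u(1) z(1) g(1) l(1) v]
          b2.limit_gradient[OF dz2 \<phi> u(2) z(2) g(2) l(2) v]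
          b1.limit_u_optimality[OF dz1 \<phi> u(1) z(1) g(1) l(1) v]
          b2.limit_u_optimality[OF dz2 \<phi> u(2) z(2) g(2) l(2) v]])
qed

end

theorem theorem2p6:
  fixes eps r eta Lc :: real
    and n mbar J1 J2 n1 n2 nh m1 m2 :: nat
    and Om1 Om2 :: "nat set"
    and w :: cvec
    and S1 S2 :: "nat \<Rightarrow> cmat"
    and A1 A2 P12 P21 :: cmat
    and f1 f2 :: "nat \<Rightarrow> real"
    and Lf :: "cvec \<Rightarrow> cvec \<Rightarrow> cvec \<Rightarrow> cvec \<Rightarrow> cvec \<Rightarrow> cvec \<Rightarrow> cvec \<Rightarrow> cvec \<Rightarrow> cvec \<Rightarrow> real"
    and u1 u2 v z1 z2 l12 l21 g1 g2 :: "nat \<Rightarrow> cvec"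
  assumes eps: "0 < eps" "eps < 1"
    and Lc_def: "Lc = 2 / eps - 1"
    and Om: "Om1 \<union> Om2 = {..<n}" "Om1 \<inter> Om2 \<noteq> {}"
    and dims: "n1 = card Om1" "n2 = card Om2" "nh = card (Om1 \<inter> Om2)"
              "m1 = J1 * mbar" "m2 = J2 * mbar"
    and S1: "scan_mats J1 mbar n1 S1" and S2: "scan_mats J2 mbar n2 S2"
    and A1_def: "A1 = Amat mbar w S1" and A2_def: "A2 = Amat mbar w S2"
    and P12_def: "P12 = pimat n (Om1 \<inter> Om2) Om1"
    and P21_def: "P21 = pimat n (Om1 \<inter> Om2) Om2"
    and f1: "\<forall>j<m1. 0 \<le> f1 j" and f2: "\<forall>j<m2. 0 \<le> f2 j"
    and Lf_def: "Lf = Lag eps r eta n1 n2 nh m1 m2 f1 f2 A1 A2 P12 P21"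
    \<comment> \<open>parameter set K\<close>
    and K: "0 < r" "0 < eta" "1 \<le> eta"
           "r - eta * Max {2 * opnorm (mm (adj A1) A1 m1) n1 n1, 2 * opnorm (mm (adj A2) A2 m2) n2 n2,
                           opnorm (mm P12 (adj A1) n1) nh m1, opnorm (mm P21 (adj A2) n2) nh m2} > 0"
           "(eta - 3 * Lc) / 2 - Lc\<^sup>2 / eta
              - 2 * (Lc + eta)\<^sup>2 / r\<^sup>2 * Max {(opnorm (mm P12 (adj A1) n1) nh m1)\<^sup>2,
                                              (opnorm (mm P21 (adj A2) n2) nh m2)\<^sup>2} > 0"
    \<comment> \<open>lower bounds on A_d\<close>
    and c1: "\<exists>c>0. \<forall>h. vnorm m1 (mv A1 m1 n1 h) \<ge> c * vnorm n1 h"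
    and c2: "\<exists>c>0. \<forall>h. vnorm m2 (mv A2 m2 n2 h) \<ge> c * vnorm n2 h"
    \<comment> \<open>initialization\<close>
    and init: "\<forall>j<n1. u1 0 j = 1" "\<forall>j<n2. u2 0 j = 1"
              "veq m1 (z1 0) (mv A1 m1 n1 (u1 0))" "veq m2 (z2 0) (mv A2 m2 n2 (u2 0))"
              "veq m1 (g1 0) 0" "veq m2 (g2 0) 0" "veq nh (l12 0) 0" "veq nh (l21 0) 0"
    \<comment> \<open>step (i)\<close>
    and z1_step: "\<forall>k. \<forall>z. G_eps eps m1 (z1 (Suc k)) f1 + eta / 2 * nsq m1 (z1 (Suc k) - (g1 k + mv A1 m1 n1 (u1 k)))
                     \<le> G_eps eps m1 z f1 + eta / 2 * nsq m1 (z - (g1 k + mv A1 m1 n1 (u1 k)))"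
    and z2_step: "\<forall>k. \<forall>z. G_eps eps m2 (z2 (Suc k)) f2 + eta / 2 * nsq m2 (z2 (Suc k) - (g2 k + mv A2 m2 n2 (u2 k)))
                     \<le> G_eps eps m2 z f2 + eta / 2 * nsq m2 (z - (g2 k + mv A2 m2 n2 (u2 k)))"
    and v_step: "\<forall>k. veq nh (v (Suc k))
                   (\<lambda>j. ((mv P12 nh n1 (u1 k) j + l12 k j) + (mv P21 nh n2 (u2 k) j + l21 k j)) / 2)"
    \<comment> \<open>step (ii)\<close>
    and g1_step: "\<forall>k. veq m1 (g1 (Suc k)) (g1 k + mv A1 m1 n1 (u1 k) - z1 (Suc k))"
    and g2_step: "\<forall>k. veq m2 (g2 (Suc k)) (g2 k + mv A2 m2 n2 (u2 k) - z2 (Suc k))"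
    \<comment> \<open>step (iii)\<close>
    and u1_step: "\<forall>k. \<forall>u. eta / 2 * nsq m1 (mv A1 m1 n1 (u1 (Suc k)) + g1 (Suc k) - z1 (Suc k))
                          + r / 2 * nsq nh (mv P12 nh n1 (u1 (Suc k)) - v (Suc k) + l12 k)
                     \<le> eta / 2 * nsq m1 (mv A1 m1 n1 u + g1 (Suc k) - z1 (Suc k))
                          + r / 2 * nsq nh (mv P12 nh n1 u - v (Suc k) + l12 k)"
    and u2_step: "\<forall>k. \<forall>u. eta / 2 * nsq m2 (mv A2 m2 n2 (u2 (Suc k)) + g2 (Suc k) - z2 (Suc k))
                          + r / 2 * nsq nh (mv P21 nh n2 (u2 (Suc k)) - v (Suc k) + l21 k)
                     \<le> eta / 2 * nsq m2 (mv A2 m2 n2 u + g2 (Suc k) - z2 (Suc k))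
                          + r / 2 * nsq nh (mv P21 nh n2 u - v (Suc k) + l21 k)"
    \<comment> \<open>step (iv)\<close>
    and l12_step: "\<forall>k. veq nh (l12 (Suc k)) (l12 k + mv P12 nh n1 (u1 (Suc k)) - v (Suc k))"
    and l21_step: "\<forall>k. veq nh (l21 (Suc k)) (l21 k + mv P21 nh n2 (u2 (Suc k)) - v (Suc k))"
  shows "\<forall>us1 us2 vs zs1 zs2 ls12 ls21 gs1 gs2.
           limit_point n1 n2 nh m1 m2 u1 u2 v z1 z2 l12 l21 g1 g2 us1 us2 vs zs1 zs2 ls12 ls21 gs1 gs2
           \<longrightarrow> stationary Lf n1 n2 nh m1 m2 us1 us2 vs zs1 zs2 ls12 ls21 gs1 gs2"
proof (intro allI impI)
  fix us1 us2 vs zs1 zs2 ls12 ls21 gs1 gs2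
  assume lim: "limit_point n1 n2 nh m1 m2 u1 u2 v z1 z2 l12 l21 g1 g2 us1 us2 vs zs1 zs2 ls12 ls21 gs1 gs2"
  let ?M = "Max {2 * opnorm (mm (adj A1) A1 m1) n1 n1, 2 * opnorm (mm (adj A2) A2 m2) n2 n2,
                           opnorm (mm P12 (adj A1) n1) nh m1, opnorm (mm P21 (adj A2) n2) nh m2}"
  have "eta * (2 * opnorm (mm (adj A1) A1 m1) n1 n1) \<le> eta * ?M"
    "eta * (2 * opnorm (mm (adj A2) A2 m2) n2 n2) \<le> eta * ?M"
    using K(2) by (intro mult_left_mono Max_ge; simp)+
  then have dom: "2 * eta * opnorm (mm (adj A1) A1 m1) n1 n1 < r" "2 * eta * opnorm (mm (adj A2) A2 m2) n2 n2 < r"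
    using K(4) by (simp_all add: mult_ac)
  have decay: "0 < decay_rate eps eta"
  proof -
    \<comment> \<open>The second parameter condition, with its nonnegative operator-norm term
      dropped and multiplied by \<open>eta\<close>, is compared with \<open>eta\<close> times the
      rate.\<close>
    define \<kappa> where "\<kappa> = 1 / eps - 1"
    have \<kappa>: "0 \<le> \<kappa>" and Lc: "Lc = 1 + 2 * \<kappa>"
      using eps by (simp_all add: \<kappa>_def Lc_def)
    let ?N = "Max {(opnorm (mm P12 (adj A1) n1) nh m1)\<^sup>2, (opnorm (mm P21 (adj A2) n2) nh m2)\<^sup>2}"
    have "(opnorm (mm P12 (adj A1) n1) nh m1)\<^sup>2 \<le> ?N" by (intro Max_ge) auto
    then have "0 \<le> ?N" by (rule order_trans[OF zero_le_power2])
    then have "0 \<le> 2 * (Lc + eta)\<^sup>2 / r\<^sup>2 * ?N" by (intro mult_nonneg_nonneg) auto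
    then have "0 < (eta - 3 * Lc) / 2 - Lc\<^sup>2 / eta" using K(5) by linarith
    then have "0 < eta * ((eta - 3 * Lc) / 2 - Lc\<^sup>2 / eta)" using K(2) by simp
    also have "\<dots> = eta\<^sup>2 / 2 - 3 / 2 * Lc * eta - Lc\<^sup>2"
      using K(2) by (simp add: field_simps power2_eq_square)
    finally have "0 < eta\<^sup>2 / 2 - 3 / 2 * eta - 3 * (\<kappa> * eta) - 1 - 4 * \<kappa> - 4 * \<kappa>\<^sup>2"
      unfolding Lc by (simp add: power2_eq_square algebra_simps add_divide_distrib)
    moreover have "0 \<le> \<kappa> * eta" "0 \<le> \<kappa>\<^sup>2" using \<kappa> K(2) by auto
    \<comment> \<open>The new expression exceeds the old by
      \<open>3/2 eta - 1 + \<kappa> eta / 2 + 4 \<kappa> + 2 \<kappa>^2\<close>, positive since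
      \<open>eta \<ge> 1\<close>.\<close>
    ultimately have "0 < eta\<^sup>2 / 2 - 5 / 2 * (\<kappa> * eta) - 2 * (1 + \<kappa>\<^sup>2)"
      using K(3) \<kappa> by argo
    also have "\<dots> = eta * (eta / 2 - 5 / 2 * \<kappa> - 2 * (1 + \<kappa>\<^sup>2) / eta)"
      using K(2) by (simp add: field_simps power2_eq_square)
    finally have "0 < eta / 2 - 5 / 2 * \<kappa> - 2 * (1 + \<kappa>\<^sup>2) / eta"
      using K(2) by (simp add: zero_less_mult_iff)
    moreover have "decay_rate eps eta = eta / 2 - 5 / 2 * \<kappa> - 2 * (1 + \<kappa>\<^sup>2) / eta"
      by (simp add: decay_rate_def \<kappa>_def)
    ultimately show ?thesis by simp
  qed
  interpret od2p eps eta r n1 n2 nh m1 m2 A1 A2 P12 P21 f1 f2 u1 u2 v z1 z2 l12 l21 g1 g2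
  proof
    show "\<exists>h. veq nh (mv P12 nh n1 h) x \<and> nsq n1 h = nsq nh x" for x
      unfolding dims(1,3) P12_def by (rule pimat_coisometry) (use Om in auto)
    show "\<exists>h. veq nh (mv P21 nh n2 h) x \<and> nsq n2 h = nsq nh x" for x
      unfolding dims(2,3) P21_def by (rule pimat_coisometry) (use Om in auto)
  qed (fact eps K(1,2) f1 f2 z1_step z2_step g1_step g2_step u1_step u2_step l12_step l21_step v_step dom decay)+
  show "stationary Lf n1 n2 nh m1 m2 us1 us2 vs zs1 zs2 ls12 ls21 gs1 gs2"
    unfolding Lf_def using lim by (rule limit_point_stationary)
qed

end
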